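(* Let $\mathbb{K}$ be a field, $\lambda\in\mathbb{K}$, $\ell\ge1$, let $k_1,\dots,k_\ell$ and $r_1>\cdots>r_\ell$ be positive integers, and let $J_\lambda=\bigoplus_{i=1}^\ell k_iJ_{\lambda,r_i}$. Let $I_\lambda\subseteq R$ be the ideal generated by the $2\times2$ minors of $(J_\lambda\boldsymbol{x}\mid\boldsymbol{x})$, let $j\in\{1,\dots,\ell\}$, let $\mathfrak{q}_{\lambda,j}=I_\lambda+I_j$ with $I_j$ as in the context, and let $R_j=R/\mathfrak{q}_{\lambda,j}$. Then the Hilbert polynomial of $R_j$ is $$H_{R_j}(t)=r_j\binom{t+k_1+\cdots+k_j-1}{t}.$$ In particular, the closed subscheme of projective space defined by $\mathfrak{q}_{\lambda,j}$ has dimension $k_1+\cdots+k_j-1$ and degree $r_j$.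
   Context: $J_{\lambda,r}$ denotes the $r\times r$ Jordan block with $\lambda$ on the diagonal and $1$ on the superdiagonal; $kJ_{\lambda,r}$ is the direct sum (block diagonal matrix) of $k$ copies of $J_{\lambda,r}$. The rows of $J_\lambda$ are indexed by $\Lambda=\{(i_1,i_2,i_3): 1\le i_1\le\ell,\ 1\le i_2\le k_{i_1},\ 1\le i_3\le r_{i_1}\}$ in lexicographically increasing order: $(i_1,i_2,i_3)$ is the $i_3$-th row of the $i_2$-th copy of $J_{\lambda,r_{i_1}}$. $R=\mathbb{K}[x(\boldsymbol{i}):\boldsymbol{i}\in\Lambda]$ with the standard grading, and $\boldsymbol{x}$ is the column vector of the variables in this order. $(J_\lambda\boldsymbol{x}\mid\boldsymbol{x})$ is the two-column matrix with columns $J_\lambda\boldsymbol{x}$ and $\boldsymbol{x}$. For $j\in\{1,\dots,\ell\}$: $\Lambda_{j,1}=\{(i_1,i_2,i_3)\in\Lambda: i_1\le j,\ r_j+1\le i_3\le r_{i_1}\}$, $\Lambda_{j,2}=\{(i_1,i_2,i_3)\in\Lambda: i_1>j\}$, and $I_j=\langle x(\boldsymbol{i}):\boldsymbol{i}\in\Lambda_{j,1}\cup\Lambda_{j,2}\rangle$ (the zero ideal if the index set is empty). The binomial coefficient $\binom{t+K-1}{t}$ is read as the polynomial $\binom{t+K-1}{K-1}$ in $t$. *)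

theory Defs
  imports
    "HOL-Library.Poly_Mapping"
    "HOL-Library.Extended_Real"
    "HOL-Algebra.QuotRing"
    "HOL-Algebra.Embedded_Algebras"
    "HOL-Analysis.Abstract_Topology"
    "HOL-Computational_Algebra.Polynomial"
    "Jordan_Normal_Form.Jordan_Normal_Form"
    "Jordan_Normal_Form.DL_Submatrix"
begin

section \<open>Polynomial rings in a set of variables\<close>

text \<open>
  Monomials are finitely supported exponent functions. The type \<open>('v, 'a) mpol\<close> is the polynomial
  ring in all variables of type \<open>'v\<close>; \<open>mpoly_ring V\<close> is its subring of polynomials in which only
  variables from \<open>V\<close> occur.
\<close>

type_synonym ('v, 'a) mpol = "('v \<Rightarrow>\<^sub>0 nat) \<Rightarrow>\<^sub>0 'a"

definition Var :: "'v \<Rightarrow> ('v, 'a::comm_ring_1) mpol" where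
  "Var v = Poly_Mapping.single (Poly_Mapping.single v 1) 1"

definition Const :: "'a \<Rightarrow> ('v, 'a::comm_ring_1) mpol" where
  "Const c = Poly_Mapping.single 0 c"

definition mpoly_ring :: "'v set \<Rightarrow> ('v, 'a::comm_ring_1) mpol ring" where
  "mpoly_ring V =
    \<lparr>carrier = {f. \<forall>m\<in>Poly_Mapping.keys f. Poly_Mapping.keys m \<subseteq> V},
     monoid.mult = (*), one = 1, zero = 0, add = (+)\<rparr>"

definition mon_degree :: "('v \<Rightarrow>\<^sub>0 nat) \<Rightarrow> nat" where
  "mon_degree m = (\<Sum>v\<in>Poly_Mapping.keys m. Poly_Mapping.lookup m v)"

text \<open>The graded component in degree \<open>t\<close> for the standard grading (it contains \<open>0\<close>).\<close>

definition graded_part :: "'v set \<Rightarrow> nat \<Rightarrow> ('v, 'a::comm_ring_1) mpol set" where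
  "graded_part V t =
    {f \<in> carrier (mpoly_ring V). \<forall>m\<in>Poly_Mapping.keys f. mon_degree m = t}"

definition homogeneous_elems :: "'v set \<Rightarrow> ('v, 'a::comm_ring_1) mpol set" where
  "homogeneous_elems V = (\<Union>t. graded_part V t)"

definition homogeneous_ideal :: "'v set \<Rightarrow> ('v, 'a::comm_ring_1) mpol set \<Rightarrow> bool" where
  "homogeneous_ideal V I \<longleftrightarrow>
    ideal I (mpoly_ring V) \<and> I = Idl\<^bsub>mpoly_ring V\<^esub> (I \<inter> homogeneous_elems V)"

definition irrelevant_ideal :: "'v set \<Rightarrow> ('v, 'a::comm_ring_1) mpol set" where
  "irrelevant_ideal V = Idl\<^bsub>mpoly_ring V\<^esub> (\<Union>t\<in>{0<..}. graded_part V t)"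

lemma cring_mpoly_ring: "cring (mpoly_ring V :: ('v, 'a::comm_ring_1) mpol ring)"
proof -
  let ?C = "{f :: ('v, 'a) mpol. \<forall>m\<in>Poly_Mapping.keys f. Poly_Mapping.keys m \<subseteq> V}"
  have add: "f + g \<in> ?C" if "f \<in> ?C" "g \<in> ?C" for f g
    using that Poly_Mapping.keys_add[of f g] by blast
  have mult: "f * g \<in> ?C" if fg: "f \<in> ?C" "g \<in> ?C" for f g
  proof (rule CollectI, rule ballI)
    fix m assume "m \<in> Poly_Mapping.keys (f * g)"
    then obtain a b where ab: "m = a + b" "a \<in> Poly_Mapping.keys f" "b \<in> Poly_Mapping.keys g"
      using Poly_Mapping.keys_mult[of f g] by blast
    then show "Poly_Mapping.keys m \<subseteq> V"
      using fg Poly_Mapping.keys_add[of a b] by blast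
  qed
  have neg: "- f \<in> ?C" if "f \<in> ?C" for f
    using that by simp
  let ?R = "mpoly_ring V :: ('v, 'a) mpol ring"
  have carrier: "carrier ?R = ?C" and ops: "x \<otimes>\<^bsub>?R\<^esub> y = x * y" "x \<oplus>\<^bsub>?R\<^esub> y = x + y"
    "\<one>\<^bsub>?R\<^esub> = 1" "\<zero>\<^bsub>?R\<^esub> = 0" for x y
    by (simp_all add: mpoly_ring_def)
  have "abelian_group ?R"
  proof (rule abelian_groupI, unfold carrier ops)
    show "0 \<in> ?C" by simp
  next
    fix f assume "f \<in> ?C"
    then show "\<exists>g\<in>?C. g + f = 0" using neg by (intro bexI[of _ "- f"]) simp_all
  qed (rule add, assumption+, simp_all only: ac_simps add_0_right)
  moreover have "comm_monoid ?R"
  proof (rule comm_monoidI, unfold carrier ops)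
    show "1 \<in> ?C" by simp
  qed (rule mult, assumption+, simp_all only: ac_simps mult_1_right)
  ultimately show ?thesis
    by (rule cringI) (simp only: ops distrib_right)
qed

section \<open>Hilbert polynomials\<close>

text \<open>
  The graded component of degree \<open>t\<close> of the quotient of \<open>mpoly_ring V\<close> by \<open>q\<close> consists of the
  cosets of the forms of degree \<open>t\<close>, and the scalars are the cosets of the constants.
\<close>

definition hilbert_function :: "'v set \<Rightarrow> ('v, 'a::field) mpol set \<Rightarrow> nat \<Rightarrow> nat" where
  "hilbert_function V q t =
    (let R = mpoly_ring V; A = R Quot q
     in (ring.dim A over ((\<lambda>c. q +>\<^bsub>R\<^esub> Const c) ` UNIV)) ((\<lambda>f. q +>\<^bsub>R\<^esub> f) ` graded_part V t))"

definition has_hilbert_poly :: "'v set \<Rightarrow> ('v, 'a::field) mpol set \<Rightarrow> rat poly \<Rightarrow> bool" where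
  "has_hilbert_poly V q H \<longleftrightarrow>
    (\<exists>N. \<forall>t\<ge>N. poly H (of_nat t) = of_nat (hilbert_function V q t))"

definition hilbert_poly :: "'v set \<Rightarrow> ('v, 'a::field) mpol set \<Rightarrow> rat poly" where
  "hilbert_poly V q = (THE H. has_hilbert_poly V q H)"

lemma has_hilbert_poly_unique:
  assumes "has_hilbert_poly V q H" "has_hilbert_poly V q H'"
  shows "H = H'"
proof -
  obtain N N' where
    "\<forall>t\<ge>N. poly H (of_nat t) = of_nat (hilbert_function V q t)"
    "\<forall>t\<ge>N'. poly H' (of_nat t) = of_nat (hilbert_function V q t)"
    using assms unfolding has_hilbert_poly_def by blast
  then have "(of_nat ` {max N N'..} :: rat set) \<subseteq> {x. poly (H - H') x = 0}"
    by auto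
  moreover have "infinite (of_nat ` {max N N'..} :: rat set)"
    by (simp add: finite_image_iff inj_on_def infinite_Ici)
  ultimately have "infinite {x. poly (H - H') x = 0}"
    using finite_subset by blast
  then show ?thesis
    using poly_roots_finite[of "H - H'"] by force
qed

lemma hilbert_poly_eq: "has_hilbert_poly V q H \<Longrightarrow> hilbert_poly V q = H"
  unfolding hilbert_poly_def using has_hilbert_poly_unique by (intro the_equality)

text \<open>The binomial coefficient \<open>t + m\<close> choose \<open>m\<close> as a polynomial in \<open>t\<close>.\<close>

definition binom_poly :: "nat \<Rightarrow> rat poly" where
  "binom_poly m = smult (1 / fact m) (\<Prod>i=0..<m. [:of_nat m - of_nat i, 1:])"

lemma poly_binom_poly: "poly (binom_poly m) x = (x + of_nat m) gchoose m"
  by (simp add: binom_poly_def gbinomial_prod_rev poly_prod algebra_simps)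

lemma poly_binom_poly_of_nat: "poly (binom_poly m) (of_nat t) = of_nat ((t + m) choose m)"
  by (simp add: poly_binom_poly binomial_gbinomial)

section \<open>Closed subschemes of projective space\<close>

definition Proj :: "'v set \<Rightarrow> ('v, 'a::field) mpol set set" where
  "Proj V = {p. primeideal p (mpoly_ring V) \<and> homogeneous_ideal V p \<and> \<not> irrelevant_ideal V \<subseteq> p}"

text \<open>The Zariski topology, with basis the loci where a given homogeneous element does not vanish.\<close>

definition zariski :: "'v set \<Rightarrow> ('v, 'a::field) mpol set topology" where
  "zariski V = topology_generated_by ((\<lambda>f. {p \<in> Proj V. f \<notin> p}) ` homogeneous_elems V)"

text \<open>The underlying topological space of the closed subscheme defined by a homogeneous ideal.\<close>

definition subscheme_space ::
    "'v set \<Rightarrow> ('v, 'a::field) mpol set \<Rightarrow> ('v, 'a) mpol set topology" where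
  "subscheme_space V q = subtopology (zariski V) {p \<in> Proj V. q \<subseteq> p}"

definition irreducible_closed :: "'p topology \<Rightarrow> 'p set \<Rightarrow> bool" where
  "irreducible_closed X Z \<longleftrightarrow> closedin X Z \<and> Z \<noteq> {} \<and>
    (\<forall>A B. closedin X A \<longrightarrow> closedin X B \<longrightarrow> Z = A \<union> B \<longrightarrow> Z = A \<or> Z = B)"

text \<open>
  The dimension of a topological space (and so of a scheme), as the supremum of the lengths of the
  chains of irreducible closed subsets. The value for the empty space is \<open>- \<infinity>\<close>.
\<close>

definition top_dim :: "'p topology \<Rightarrow> ereal" where
  "top_dim X = (SUP n \<in> {n. \<exists>Z. (\<forall>i\<le>n. irreducible_closed X (Z i)) \<and> (\<forall>i<n. Z i \<subset> Z (Suc i))}.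
     ereal (real n))"

definition subscheme_dim :: "'v set \<Rightarrow> ('v, 'a::field) mpol set \<Rightarrow> ereal" where
  "subscheme_dim V q = top_dim (subscheme_space V q)"

definition subscheme_degree :: "'v set \<Rightarrow> ('v, 'a::field) mpol set \<Rightarrow> rat" where
  "subscheme_degree V q = fact (Polynomial.degree (hilbert_poly V q)) * lead_coeff (hilbert_poly V q)"

section \<open>The ideals attached to a Jordan matrix\<close>

type_synonym idx = "nat \<times> nat \<times> nat"

definition Lam :: "nat \<Rightarrow> (nat \<Rightarrow> nat) \<Rightarrow> (nat \<Rightarrow> nat) \<Rightarrow> idx set" where
  "Lam l k r = {(a, b, c). a \<in> {1..l} \<and> b \<in> {1..k a} \<and> c \<in> {1..r a}}"

definition Lam_list :: "nat \<Rightarrow> (nat \<Rightarrow> nat) \<Rightarrow> (nat \<Rightarrow> nat) \<Rightarrow> idx list" where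
  "Lam_list l k r = [(a, b, c). a \<leftarrow> [1..<Suc l], b \<leftarrow> [1..<Suc (k a)], c \<leftarrow> [1..<Suc (r a)]]"

lemma set_Lam_list: "set (Lam_list l k r) = Lam l k r"
  unfolding Lam_list_def Lam_def by (force simp: image_iff simp del: upt_Suc)

definition J_mat :: "'a::field \<Rightarrow> nat \<Rightarrow> (nat \<Rightarrow> nat) \<Rightarrow> (nat \<Rightarrow> nat) \<Rightarrow> 'a mat" where
  "J_mat lam l k r = jordan_matrix (concat (map (\<lambda>i. replicate (k i) (r i, lam)) [1..<Suc l]))"

definition x_vec :: "nat \<Rightarrow> (nat \<Rightarrow> nat) \<Rightarrow> (nat \<Rightarrow> nat) \<Rightarrow> (idx, 'a::field) mpol vec" where
  "x_vec l k r = vec_of_list (map Var (Lam_list l k r))"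

definition Jx_x_mat :: "'a::field \<Rightarrow> nat \<Rightarrow> (nat \<Rightarrow> nat) \<Rightarrow> (nat \<Rightarrow> nat) \<Rightarrow> (idx, 'a) mpol mat" where
  "Jx_x_mat lam l k r =
    mat_of_cols (length (Lam_list l k r))
      [map_mat Const (J_mat lam l k r) *\<^sub>v x_vec l k r, x_vec l k r]"

definition minors :: "nat \<Rightarrow> 'b::comm_ring_1 mat \<Rightarrow> 'b set" where
  "minors n A = {det (submatrix A I J) | I J.
     I \<subseteq> {..<dim_row A} \<and> card I = n \<and> J \<subseteq> {..<dim_col A} \<and> card J = n}"

definition I_lam :: "'a::field \<Rightarrow> nat \<Rightarrow> (nat \<Rightarrow> nat) \<Rightarrow> (nat \<Rightarrow> nat) \<Rightarrow> (idx, 'a) mpol set" where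
  "I_lam lam l k r = Idl\<^bsub>mpoly_ring (Lam l k r)\<^esub> (minors 2 (Jx_x_mat lam l k r))"

definition Lam1 :: "nat \<Rightarrow> (nat \<Rightarrow> nat) \<Rightarrow> (nat \<Rightarrow> nat) \<Rightarrow> nat \<Rightarrow> idx set" where
  "Lam1 l k r j = {(a, b, c) \<in> Lam l k r. a \<le> j \<and> r j + 1 \<le> c \<and> c \<le> r a}"

definition Lam2 :: "nat \<Rightarrow> (nat \<Rightarrow> nat) \<Rightarrow> (nat \<Rightarrow> nat) \<Rightarrow> nat \<Rightarrow> idx set" where
  "Lam2 l k r j = {(a, b, c) \<in> Lam l k r. a > j}"

definition I_sub :: "nat \<Rightarrow> (nat \<Rightarrow> nat) \<Rightarrow> (nat \<Rightarrow> nat) \<Rightarrow> nat \<Rightarrow> (idx, 'a::field) mpol set" where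
  "I_sub l k r j = Idl\<^bsub>mpoly_ring (Lam l k r)\<^esub> (Var ` (Lam1 l k r j \<union> Lam2 l k r j))"

definition q_ideal ::
    "'a::field \<Rightarrow> nat \<Rightarrow> (nat \<Rightarrow> nat) \<Rightarrow> (nat \<Rightarrow> nat) \<Rightarrow> nat \<Rightarrow> (idx, 'a) mpol set" where
  "q_ideal lam l k r j = I_lam lam l k r <+>\<^bsub>mpoly_ring (Lam l k r)\<^esub> I_sub l k r j"

end

theory Submission
  imports Defs "HOL-Library.Product_Lexorder" "HOL-Library.Product_Plus"
begin

text \<open>
  Modulo the variables in \<open>I\<^sub>j\<close>, the minors read \<open>x\<^sub>p\<^sub>+\<^sub>1 x\<^sub>q = x\<^sub>p x\<^sub>q\<^sub>+\<^sub>1\<close>, where a variable past the end of its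
  block is zero. Hence a monomial modulo \<open>q\<close> only depends on the blocks it meets and on the total
  shift of its factors inside their blocks, and it vanishes when this shift reaches \<open>r\<^sub>j\<close>: the ideal \<open>q\<close>
  is the kernel of the map \<open>x(a,b,c) \<mapsto> s ^ (c - 1) z(a,b)\<close> to \<open>K[s,z]/(s ^ r\<^sub>j)\<close>. In degree \<open>t > 0\<close> its image has a
  basis of \<open>r\<^sub>j\<close> copies of the monomials of degree \<open>t\<close> in the \<open>z(a,b)\<close>.

  A chain of \<open>n + 1\<close> irreducible closed sets yields \<open>n\<close> forms, each in one vanishing ideal and not in
  the next smaller one, which together with a form outside all of these ideals are algebraically
  independent modulo \<open>q\<close>. So the Hilbert function of \<open>q\<close> grows at least like \<open>t\<^sup>n\<close>, which bounds \<open>n\<close>.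
  Chains of coordinate subspaces attain the bound.
\<close>

section \<open>Polynomial rings and their ideals\<close>

text \<open>The hard inclusion is that of the kernel in \<open>q\<close>: two monomials with equal
  images must be congruent modulo \<open>q\<close>. The normal form used for this piles the whole
  shift on a single factor, so it needs a factor to begin with. This is why the degree has to be
  positive: in degree 0 the quotient has dimension 1, not \<open>r j\<close>.

  The field may be finite, so nothing can rest on rational points; points are homogeneous primes
  throughout. In the upper bound an irreducible closed set enters only through its vanishing ideal,
  for which irreducibility says that a product of two forms lies in it only if a factor does. The
  forms that separate consecutive members of a chain have unrelated degrees. The form outside all
  ideals, of degree \<open>e\<close>, brings their products to one common degree; this requires
  degrees divisible by \<open>e\<close>, hence the exponents \<open>e * s\<close>. With exponents up
  to \<open>T\<close> there are \<open>(T + 1) ^ n\<close> products in a degree linear in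
  \<open>T\<close>, where the available dimension only grows like the power of \<open>T\<close> with
  exponent \<open>k 1 + ... + k j - 1\<close>.\<close>

abbreviation monomial :: "('v \<Rightarrow>\<^sub>0 nat) \<Rightarrow> ('v, 'a::comm_ring_1) mpol" where
  "monomial m \<equiv> Poly_Mapping.single m 1"

lemma poly_mapping_eq_sum_single:
  "f = (\<Sum>m\<in>Poly_Mapping.keys f. Poly_Mapping.single m (Poly_Mapping.lookup f m))"
proof (rule poly_mapping_eqI)
  fix k
  show "Poly_Mapping.lookup f k =
      Poly_Mapping.lookup (\<Sum>m\<in>Poly_Mapping.keys f. Poly_Mapping.single m (Poly_Mapping.lookup f m)) k"
    by (simp add: lookup_sum lookup_single when_def sum.delta in_keys_iff)
qed

lemma single_eq_Const_mult: "Poly_Mapping.single m c = Const c * monomial m"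
  by (simp add: Const_def mult_single)

lemma lookup_single_zero_mult:
  fixes f :: "'k::comm_monoid_add \<Rightarrow>\<^sub>0 'a::comm_ring_1"
  shows "Poly_Mapping.lookup (Poly_Mapping.single 0 c * f) m = c * Poly_Mapping.lookup f m"
  by (simp flip: mult_map_scale_conv_mult add: Poly_Mapping.map.rep_eq when_def)

lemma Const_0 [simp]: "Const 0 = 0"
  and Const_1 [simp]: "Const 1 = 1"
  and Const_add: "Const (a + b) = Const a + Const b"
  and Const_mult: "Const (a * b) = Const a * Const b"
  and Const_uminus: "Const (- a) = - Const a"
  by (simp_all add: Const_def single_add mult_single single_uminus)

section \<open>Linear maps between monoid algebras\<close>

definition linear_extension ::
    "('k \<Rightarrow> 'm \<Rightarrow>\<^sub>0 'a) \<Rightarrow> ('k \<Rightarrow>\<^sub>0 'a) \<Rightarrow> ('m::comm_monoid_add \<Rightarrow>\<^sub>0 'a::comm_ring_1)" where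
  "linear_extension \<phi> f =
    (\<Sum>m\<in>Poly_Mapping.keys f. Poly_Mapping.single 0 (Poly_Mapping.lookup f m) * \<phi> m)"

lemma linear_extension_0 [simp]: "linear_extension \<phi> 0 = 0"
  by (simp add: linear_extension_def)

lemma linear_extension_single:
  "linear_extension \<phi> (Poly_Mapping.single m c) = Poly_Mapping.single 0 c * \<phi> m"
  by (cases "c = 0") (simp_all add: linear_extension_def)

lemma linear_extension_add:
  "linear_extension \<phi> (f + g) = linear_extension \<phi> f + linear_extension \<phi> g"
  unfolding linear_extension_def
  by (rule setsum_keys_plus_distrib) (simp_all add: single_add distrib_right)

lemma linear_extension_sum:
  "linear_extension \<phi> (\<Sum>x\<in>A. f x) = (\<Sum>x\<in>A. linear_extension \<phi> (f x))"
  by (induction A rule: infinite_finite_induct) (simp_all add: linear_extension_add)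

lemma linear_extension_uminus: "linear_extension \<phi> (- f) = - linear_extension \<phi> f"
proof -
  have "linear_extension \<phi> (- f) + linear_extension \<phi> f = 0"
    by (simp flip: linear_extension_add)
  then show ?thesis by (simp only: eq_neg_iff_add_eq_0)
qed

lemma linear_extension_diff:
  "linear_extension \<phi> (f - g) = linear_extension \<phi> f - linear_extension \<phi> g"
  using linear_extension_add[of \<phi> f "- g"] by (simp add: linear_extension_uminus)

text \<open>Both sides are additive in \<open>f\<close> and in \<open>g\<close>, so single terms
  suffice. The substitution of monomials for variables and that of 0 for some variables are both of
  this kind.\<close>

lemma linear_extension_mult:
  fixes f g :: "'k::comm_monoid_add \<Rightarrow>\<^sub>0 'a::comm_ring_1"
  assumes "\<And>a b. \<phi> (a + b) = \<phi> a * \<phi> b"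
  shows "linear_extension \<phi> (f * g) = linear_extension \<phi> f * linear_extension \<phi> g"
proof -
  let ?S = "\<lambda>f. \<Sum>m\<in>Poly_Mapping.keys f. Poly_Mapping.single m (Poly_Mapping.lookup f m)"
  have "linear_extension \<phi> (Poly_Mapping.single a c * Poly_Mapping.single b d) =
      linear_extension \<phi> (Poly_Mapping.single a c) * linear_extension \<phi> (Poly_Mapping.single b d)"
    for a b c d
  proof -
    have "Poly_Mapping.single (0::'b) (c * d) = Poly_Mapping.single 0 c * Poly_Mapping.single 0 d"
      by (simp add: mult_single)
    then show ?thesis
      by (simp add: mult_single linear_extension_single assms mult_ac)
  qed
  then have "linear_extension \<phi> (?S f * ?S g) = linear_extension \<phi> (?S f) * linear_extension \<phi> (?S g)"
    by (simp only: sum_product linear_extension_sum)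
  then show ?thesis
    by (simp only: poly_mapping_eq_sum_single[symmetric])
qed

lemma linear_extension_Const_mult:
  "linear_extension \<phi> (Const c * f) = Poly_Mapping.single 0 c * linear_extension \<phi> f"
proof -
  let ?S = "\<lambda>f. \<Sum>m\<in>Poly_Mapping.keys f. Poly_Mapping.single m (Poly_Mapping.lookup f m)"
  have "linear_extension \<phi> (Const c * Poly_Mapping.single m d) =
      Poly_Mapping.single 0 c * linear_extension \<phi> (Poly_Mapping.single m d)" for m d
  proof -
    have "Poly_Mapping.single (0::'b) (c * d) = Poly_Mapping.single 0 c * Poly_Mapping.single 0 d"
      by (simp add: mult_single)
    then show ?thesis
      by (simp add: Const_def mult_single linear_extension_single mult_ac)
  qed
  then have "linear_extension \<phi> (Const c * ?S f) = Poly_Mapping.single 0 c * linear_extension \<phi> (?S f)"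
    by (simp only: sum_distrib_left linear_extension_sum)
  then show ?thesis
    by (simp only: poly_mapping_eq_sum_single[symmetric])
qed

lemma keys_add_nat: "Poly_Mapping.keys (a + b) = Poly_Mapping.keys a \<union> Poly_Mapping.keys b"
  for a b :: "'v \<Rightarrow>\<^sub>0 nat"
  by (auto simp: in_keys_iff lookup_add)

lemma mon_degree_0 [simp]: "mon_degree 0 = 0"
  by (simp add: mon_degree_def)

lemma mon_degree_add: "mon_degree (a + b) = mon_degree a + mon_degree b"
  unfolding mon_degree_def by (rule setsum_keys_plus_distrib) simp_all

lemma mon_degree_single [simp]: "mon_degree (Poly_Mapping.single v n) = n"
  by (simp add: mon_degree_def)

lemma keys_diff_subset:
  "Poly_Mapping.keys (f - g) \<subseteq> Poly_Mapping.keys f \<union> Poly_Mapping.keys g"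
  for f g :: "'k \<Rightarrow>\<^sub>0 'a::ab_group_add"
  by (auto simp: in_keys_iff lookup_minus)

section \<open>The polynomial ring in a set of variables and its ideals\<close>

lemma mpoly_ring_simps [simp]:
  "monoid.mult (mpoly_ring V) = (*)" "one (mpoly_ring V) = 1" "zero (mpoly_ring V) = 0"
  "add (mpoly_ring V) = (+)"
  by (simp_all add: mpoly_ring_def)

lemma in_carrier_mpoly_ring:
  "f \<in> carrier (mpoly_ring V) \<longleftrightarrow> (\<forall>m\<in>Poly_Mapping.keys f. Poly_Mapping.keys m \<subseteq> V)"
  by (simp add: mpoly_ring_def)

lemma ring_mpoly_ring: "ring (mpoly_ring V :: ('v, 'a::comm_ring_1) mpol ring)"
  using cring_mpoly_ring cring.axioms(1) by blast

lemma mpoly_ring_closed [simp]: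
  fixes f g :: "('v, 'a::comm_ring_1) mpol"
  shows "0 \<in> carrier (mpoly_ring V :: ('v, 'a) mpol ring)"
    and "1 \<in> carrier (mpoly_ring V :: ('v, 'a) mpol ring)"
    and "f \<in> carrier (mpoly_ring V) \<Longrightarrow> - f \<in> carrier (mpoly_ring V)"
    and "f \<in> carrier (mpoly_ring V) \<Longrightarrow> g \<in> carrier (mpoly_ring V) \<Longrightarrow> f + g \<in> carrier (mpoly_ring V)"
    and "f \<in> carrier (mpoly_ring V) \<Longrightarrow> g \<in> carrier (mpoly_ring V) \<Longrightarrow> f - g \<in> carrier (mpoly_ring V)"
    and "f \<in> carrier (mpoly_ring V) \<Longrightarrow> g \<in> carrier (mpoly_ring V) \<Longrightarrow> f * g \<in> carrier (mpoly_ring V)"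
    and "Const c \<in> carrier (mpoly_ring V :: ('v, 'a) mpol ring)"
proof -
  interpret cring "mpoly_ring V :: ('v, 'a) mpol ring" by (rule cring_mpoly_ring)
  show "0 \<in> carrier (mpoly_ring V :: ('v, 'a) mpol ring)"
    "1 \<in> carrier (mpoly_ring V :: ('v, 'a) mpol ring)"
    using zero_closed one_closed by simp_all
  show *: "- f \<in> carrier (mpoly_ring V)" if "f \<in> carrier (mpoly_ring V)" for f :: "('v, 'a) mpol"
    using that by (simp add: in_carrier_mpoly_ring)
  show **: "f + g \<in> carrier (mpoly_ring V)"
    if "f \<in> carrier (mpoly_ring V)" "g \<in> carrier (mpoly_ring V)" for f g :: "('v, 'a) mpol"
    using a_closed that by simp
  show "f - g \<in> carrier (mpoly_ring V)"
    if "f \<in> carrier (mpoly_ring V)" "g \<in> carrier (mpoly_ring V)"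
    using *[of g] **[of f "- g"] that by simp
  show "f * g \<in> carrier (mpoly_ring V)"
    if "f \<in> carrier (mpoly_ring V)" "g \<in> carrier (mpoly_ring V)"
    using m_closed that by simp
  show "Const c \<in> carrier (mpoly_ring V :: ('v, 'a) mpol ring)"
    by (auto simp: in_carrier_mpoly_ring Const_def in_keys_iff lookup_single when_def)
qed

lemma single_in_carrier:
  "Poly_Mapping.keys m \<subseteq> V \<Longrightarrow> Poly_Mapping.single m c \<in> carrier (mpoly_ring V)"
  by (auto simp: in_carrier_mpoly_ring)

lemma Var_in_carrier: "v \<in> V \<Longrightarrow> Var v \<in> carrier (mpoly_ring V)"
  unfolding Var_def by (rule single_in_carrier) simp

lemma ideal_mpoly_ringD:
  fixes I :: "('v, 'a::comm_ring_1) mpol set"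
  assumes "ideal I (mpoly_ring V)"
  shows "I \<subseteq> carrier (mpoly_ring V)" and "0 \<in> I"
    and "f \<in> I \<Longrightarrow> g \<in> I \<Longrightarrow> f + g \<in> I"
    and "f \<in> I \<Longrightarrow> - f \<in> I"
    and "f \<in> I \<Longrightarrow> g \<in> I \<Longrightarrow> f - g \<in> I"
    and "f \<in> I \<Longrightarrow> g \<in> carrier (mpoly_ring V) \<Longrightarrow> g * f \<in> I"
    and "f \<in> I \<Longrightarrow> Const c * f \<in> I"
proof -
  interpret ideal I "mpoly_ring V" by (rule assms)
  show "I \<subseteq> carrier (mpoly_ring V)" using a_subset by blast
  show "0 \<in> I" using additive_subgroup.zero_closed[OF additive_subgroup_axioms] by simp
  show add: "f + g \<in> I" if "f \<in> I" "g \<in> I" for f g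
    using additive_subgroup.a_closed[OF additive_subgroup_axioms that] by simp
  show mult: "g * f \<in> I" if "f \<in> I" "g \<in> carrier (mpoly_ring V)" for f g
    using I_l_closed[OF that] by simp
  show c: "Const c * f \<in> I" if "f \<in> I" for f c using that mult by simp
  show minus: "- f \<in> I" if "f \<in> I" for f
    using c[OF that, of "- 1"] by (simp add: Const_uminus)
  show "f - g \<in> I" if "f \<in> I" "g \<in> I"
    using add[OF that(1) minus[OF that(2)]] by simp
qed

lemma ideal_sum:
  "ideal I (mpoly_ring V) \<Longrightarrow> (\<And>x. x \<in> A \<Longrightarrow> f x \<in> I) \<Longrightarrow> (\<Sum>x\<in>A. f x) \<in> I"
  by (induction A rule: infinite_finite_induct) (auto intro: ideal_mpoly_ringD)

lemma ideal_mpoly_ringI: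
  fixes I :: "('v, 'a::comm_ring_1) mpol set"
  assumes "I \<subseteq> carrier (mpoly_ring V)" and "0 \<in> I"
    and add: "\<And>f g. f \<in> I \<Longrightarrow> g \<in> I \<Longrightarrow> f + g \<in> I"
    and mult: "\<And>f g. f \<in> I \<Longrightarrow> g \<in> carrier (mpoly_ring V) \<Longrightarrow> g * f \<in> I"
  shows "ideal I (mpoly_ring V)"
proof (rule idealI)
  interpret R: cring "mpoly_ring V :: ('v, 'a) mpol ring" by (rule cring_mpoly_ring)
  have neg: "- f \<in> I" if "f \<in> I" for f
    using mult[OF that, of "- 1"] by simp
  have inv: "inv\<^bsub>add_monoid (mpoly_ring V)\<^esub> f = - f" if "f \<in> I" for f
  proof -
    have f: "f \<in> carrier (mpoly_ring V)" using that assms(1) by blast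
    then have "\<ominus>\<^bsub>mpoly_ring V\<^esub> f = - f"
      by (intro R.minus_equality) simp_all
    then show ?thesis by (simp add: a_inv_def)
  qed
  show "ring (mpoly_ring V :: ('v, 'a) mpol ring)" by (rule ring_mpoly_ring)
  show "subgroup I (add_monoid (mpoly_ring V))"
    by (rule subgroup.intro) (use assms(1,2) add neg inv in auto)
  show "x \<otimes>\<^bsub>mpoly_ring V\<^esub> a \<in> I" "a \<otimes>\<^bsub>mpoly_ring V\<^esub> x \<in> I"
    if "a \<in> I" "x \<in> carrier (mpoly_ring V)" for a x
    using mult[OF that] by (simp_all add: mult.commute)
qed

lemma genideal_mpoly_ring:
  fixes S :: "('v, 'a::comm_ring_1) mpol set"
  assumes "S \<subseteq> carrier (mpoly_ring V)"
  shows "ideal (Idl\<^bsub>mpoly_ring V\<^esub> S) (mpoly_ring V)" and "S \<subseteq> Idl\<^bsub>mpoly_ring V\<^esub> S"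
  using ring.genideal_ideal[OF ring_mpoly_ring assms] ring.genideal_self[OF ring_mpoly_ring assms]
  by auto

lemma genideal_mpoly_ring_le:
  fixes S :: "('v, 'a::comm_ring_1) mpol set"
  shows "ideal I (mpoly_ring V) \<Longrightarrow> S \<subseteq> I \<Longrightarrow> Idl\<^bsub>mpoly_ring V\<^esub> S \<subseteq> I"
  using ring.genideal_minimal[OF ring_mpoly_ring] by blast

lemma sum_ideals_mpoly_ring:
  fixes I J :: "('v, 'a::comm_ring_1) mpol set"
  assumes "ideal I (mpoly_ring V)" and "ideal J (mpoly_ring V)"
  shows "ideal (I <+>\<^bsub>mpoly_ring V\<^esub> J) (mpoly_ring V)"
    and "I \<union> J \<subseteq> I <+>\<^bsub>mpoly_ring V\<^esub> J"
    and "\<lbrakk>ideal K (mpoly_ring V); I \<subseteq> K; J \<subseteq> K\<rbrakk> \<Longrightarrow> I <+>\<^bsub>mpoly_ring V\<^esub> J \<subseteq> K"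
proof -
  show "ideal (I <+>\<^bsub>mpoly_ring V\<^esub> J) (mpoly_ring V)"
    by (rule ring.add_ideals[OF ring_mpoly_ring assms])
  have mem: "f \<in> I <+>\<^bsub>mpoly_ring V\<^esub> J \<longleftrightarrow> (\<exists>a\<in>I. \<exists>b\<in>J. f = a + b)" for f
    by (simp add: AbelCoset.set_add_def set_mult_def)
  show "I \<union> J \<subseteq> I <+>\<^bsub>mpoly_ring V\<^esub> J"
  proof
    fix f assume "f \<in> I \<union> J"
    moreover have "f = f + 0" "f = 0 + f" by simp_all
    ultimately show "f \<in> I <+>\<^bsub>mpoly_ring V\<^esub> J"
      using ideal_mpoly_ringD(2)[OF assms(1)] ideal_mpoly_ringD(2)[OF assms(2)] unfolding mem by blast
  qed
  show "I <+>\<^bsub>mpoly_ring V\<^esub> J \<subseteq> K" if K: "ideal K (mpoly_ring V)" "I \<subseteq> K" "J \<subseteq> K"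
  proof
    fix f assume "f \<in> I <+>\<^bsub>mpoly_ring V\<^esub> J"
    then obtain a b where "a \<in> K" "b \<in> K" "f = a + b"
      using K(2,3) unfolding mem by blast
    then show "f \<in> K" using ideal_mpoly_ringD(3)[OF K(1)] by simp
  qed
qed

section \<open>Forms of a fixed degree\<close>

lemma graded_partD:
  assumes "f \<in> graded_part V t"
  shows "f \<in> carrier (mpoly_ring V)" "m \<in> Poly_Mapping.keys f \<Longrightarrow> mon_degree m = t"
    "m \<in> Poly_Mapping.keys f \<Longrightarrow> Poly_Mapping.keys m \<subseteq> V"
  using assms by (auto simp: graded_part_def in_carrier_mpoly_ring)

lemma single_in_graded_part:
  "Poly_Mapping.keys m \<subseteq> V \<Longrightarrow> Poly_Mapping.single m c \<in> graded_part V (mon_degree m)"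
  by (simp add: graded_part_def in_carrier_mpoly_ring)

lemma graded_part_0 [simp]: "0 \<in> graded_part V t"
  by (simp add: graded_part_def)

lemma graded_part_1 [simp]: "1 \<in> graded_part V 0"
  by (simp add: graded_part_def)

lemma graded_part_add: "f \<in> graded_part V t \<Longrightarrow> g \<in> graded_part V t \<Longrightarrow> f + g \<in> graded_part V t"
  using Poly_Mapping.keys_add[of f g] by (auto simp: graded_part_def)

lemma graded_part_diff: "f \<in> graded_part V t \<Longrightarrow> g \<in> graded_part V t \<Longrightarrow> f - g \<in> graded_part V t"
  using keys_diff_subset[of f g] by (auto simp: graded_part_def)

lemma graded_part_mult:
  assumes "f \<in> graded_part V s" and "g \<in> graded_part V t"
  shows "f * g \<in> graded_part V (s + t)"
proof -
  have "mon_degree m = s + t" if m: "m \<in> Poly_Mapping.keys (f * g)" for m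
  proof -
    obtain a b where "m = a + b" "a \<in> Poly_Mapping.keys f" "b \<in> Poly_Mapping.keys g"
      using m Poly_Mapping.keys_mult[of f g] by blast
    then show ?thesis
      using assms by (simp add: graded_part_def mon_degree_add)
  qed
  then show ?thesis
    using assms by (simp add: graded_part_def)
qed

lemma graded_part_power: "f \<in> graded_part V s \<Longrightarrow> f ^ n \<in> graded_part V (n * s)"
  by (induction n) (auto intro: graded_part_mult)

lemma graded_part_Const_mult: "f \<in> graded_part V t \<Longrightarrow> Const c * f \<in> graded_part V t"
  using graded_part_mult[of "Const c" V 0 f t] single_in_graded_part[of 0 V c]
  by (simp add: Const_def)

lemma graded_part_sum:
  "(\<And>x. x \<in> A \<Longrightarrow> f x \<in> graded_part V t) \<Longrightarrow> (\<Sum>x\<in>A. f x) \<in> graded_part V t"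
  by (induction A rule: infinite_finite_induct) (auto intro: graded_part_add)

section \<open>The minors attached to a Jordan matrix\<close>

lemma det_carrier_2:
  fixes A :: "'b::comm_ring_1 mat"
  assumes A: "A \<in> carrier_mat 2 2"
  shows "det A = A $$ (0, 0) * A $$ (1, 1) - A $$ (0, 1) * A $$ (1, 0)"
proof -
  have minor: "det (mat_delete A 0 j) = mat_delete A 0 j $$ (0, 0)" if "j < 2" for j
    using A that by (intro det_single) (auto intro!: carrier_matI)
  have "det A = (\<Sum>j<2. A $$ (0, j) * cofactor A 0 j)"
    using laplace_expansion_row[OF A, of 0] by simp
  also have "\<dots> = A $$ (0, 0) * A $$ (1, 1) - A $$ (0, 1) * A $$ (1, 0)"
    using A minor by (simp add: cofactor_def numeral_2_eq_2 mat_delete_def)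
  finally show ?thesis .
qed

section \<open>Jordan matrices acting on vectors\<close>

lemma vec_of_list_append: "vec_of_list (xs @ ys) = vec_of_list xs @\<^sub>v vec_of_list ys"
  by (rule eq_vecI) (auto simp: vec_of_list_index nth_append)

lemma jordan_block_mult_vec:
  fixes f :: "nat \<Rightarrow> 'b::comm_ring_1"
  shows "jordan_block n a *\<^sub>v vec_of_list (map f [0..<n]) =
    vec_of_list (map (\<lambda>c. a * f c + (if Suc c < n then f (Suc c) else 0)) [0..<n])"
proof (rule eq_vecI)
  fix i assume "i < dim_vec (vec_of_list (map (\<lambda>c. a * f c + (if Suc c < n then f (Suc c) else 0)) [0..<n]))"
  then have i: "i < n" by simp
  have "(jordan_block n a *\<^sub>v vec_of_list (map f [0..<n])) $ i =
      (\<Sum>j = 0..<n. (if i = j then a else if Suc i = j then 1 else 0) * f j)"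
    using i by (simp add: scalar_prod_def vec_of_list_index del: vec_of_list_map)
  also have "\<dots> = (\<Sum>j = 0..<n. (if j = i then a * f j else 0) + (if j = Suc i then f j else 0))"
    by (rule sum.cong) auto
  also have "\<dots> = a * f i + (if Suc i < n then f (Suc i) else 0)"
    using i by (simp add: sum.distrib sum.delta)
  finally show "(jordan_block n a *\<^sub>v vec_of_list (map f [0..<n])) $ i =
      vec_of_list (map (\<lambda>c. a * f c + (if Suc c < n then f (Suc c) else 0)) [0..<n]) $ i"
    using i by (simp add: vec_of_list_index del: vec_of_list_map)
qed simp

lemma jordan_matrix_Cons:
  "jordan_matrix ((n, a) # xs) =
    four_block_mat (jordan_block n a) (0\<^sub>m n (sum_list (map fst xs))) (0\<^sub>m (sum_list (map fst xs)) n)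
      (jordan_matrix xs)"
  using jordan_matrix_dim[of xs] by (simp add: jordan_matrix_def Let_def)

text \<open>A list of pairs (size, entries) cuts the matrix and the vector at the same places, so
  the induction can split off the first block; the off-diagonal zero blocks contribute
  nothing.\<close>

lemma jordan_matrix_mult_vec:
  fixes bs :: "(nat \<times> (nat \<Rightarrow> 'b::comm_ring_1)) list"
  shows "jordan_matrix (map (\<lambda>(n, f). (n, a)) bs) *\<^sub>v
      vec_of_list (concat (map (\<lambda>(n, f). map f [0..<n]) bs)) =
    vec_of_list (concat (map (\<lambda>(n, f).
      map (\<lambda>c. a * f c + (if Suc c < n then f (Suc c) else 0)) [0..<n]) bs))"
proof (induction bs)
  case Nil
  show ?case by (rule eq_vecI) (simp_all add: jordan_matrix_def)
next
  case (Cons b bs)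
  obtain n f where b: "b = (n, f)" by (cases b)
  let ?s = "sum_list (map fst (map (\<lambda>(n, f). (n, a)) bs))"
  let ?v = "vec_of_list (concat (map (\<lambda>(n, f). map f [0..<n]) bs))"
  let ?u = "vec_of_list (map f [0..<n])"
  have s: "?s = length (concat (map (\<lambda>(n, f). map f [0..<n]) bs))"
    by (induction bs) auto
  have v: "?v \<in> carrier_vec ?s"
    unfolding s carrier_vec_def by simp
  have u: "?u \<in> carrier_vec n"
    unfolding carrier_vec_def by simp
  have J: "jordan_matrix (map (\<lambda>(n, f). (n, a)) bs) \<in> carrier_mat ?s ?s"
    by (rule jordan_matrix_carrier)
  have "jordan_matrix (map (\<lambda>(n, f). (n, a)) (b # bs)) *\<^sub>v (?u @\<^sub>v ?v) =
      (jordan_block n a *\<^sub>v ?u + 0\<^sub>m n ?s *\<^sub>v ?v) @\<^sub>v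
      (0\<^sub>m ?s n *\<^sub>v ?u + jordan_matrix (map (\<lambda>(n, f). (n, a)) bs) *\<^sub>v ?v)"
    unfolding b list.map prod.case jordan_matrix_Cons
    by (rule four_block_mat_mult_vec) (use u v J in auto)
  also have "\<dots> = (jordan_block n a *\<^sub>v ?u) @\<^sub>v (jordan_matrix (map (\<lambda>(n, f). (n, a)) bs) *\<^sub>v ?v)"
  proof -
    have "0\<^sub>m n ?s *\<^sub>v ?v = 0\<^sub>v n" "0\<^sub>m ?s n *\<^sub>v ?u = 0\<^sub>v ?s"
      using u v by (auto intro!: eq_vecI simp del: vec_of_list_map)
    moreover have "jordan_block n a *\<^sub>v ?u \<in> carrier_vec n"
      using u by (intro mult_mat_vec_carrier[of _ n n]) auto
    moreover have "jordan_matrix (map (\<lambda>(n, f). (n, a)) bs) *\<^sub>v ?v \<in> carrier_vec ?s"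
      using v J by (intro mult_mat_vec_carrier[of _ ?s ?s]) auto
    ultimately show ?thesis by (simp only: right_zero_vec left_zero_vec)
  qed
  finally show ?case
    by (simp only: b list.map prod.case concat.simps vec_of_list_append jordan_block_mult_vec Cons.IH)
qed

lemma map_mat_jordan_matrix:
  assumes "h 0 = 0" and "h 1 = 1"
  shows "map_mat h (jordan_matrix xs) = jordan_matrix (map (\<lambda>(n, a). (n, h a)) xs)"
proof (induction xs)
  case Nil
  show ?case by (rule eq_matI) (simp_all add: jordan_matrix_def)
next
  case (Cons x xs)
  obtain n a where x: "x = (n, a)" by (cases x)
  have s: "map fst (map (\<lambda>(n, a). (n, h a)) xs) = map fst xs"
    by (induction xs) auto
  have "map_mat h (jordan_block n a) = jordan_block n (h a)"
    by (rule eq_matI) (auto simp: assms)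
  moreover have "map_mat h (0\<^sub>m i j) = 0\<^sub>m i j" for i j
    by (rule eq_matI) (auto simp: assms)
  moreover have "map_mat h (jordan_matrix (x # xs)) =
      four_block_mat (map_mat h (jordan_block n a))
        (map_mat h (0\<^sub>m n (sum_list (map fst xs)))) (map_mat h (0\<^sub>m (sum_list (map fst xs)) n))
        (map_mat h (jordan_matrix xs))"
    unfolding x jordan_matrix_Cons
    by (rule map_four_block_mat[OF jordan_block_carrier zero_carrier_mat zero_carrier_mat jordan_matrix_carrier])
  ultimately show ?case
    by (simp only: x list.map prod.case jordan_matrix_Cons Cons.IH s)
qed

text \<open>The entry at \<open>v\<close> of the nilpotent part of the Jordan matrix applied to the
  vector of variables. The value 0 stems from the last row of a Jordan block, which has no
  superdiagonal entry.\<close>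

definition succ_Var :: "(nat \<Rightarrow> nat) \<Rightarrow> idx \<Rightarrow> (idx, 'a::field) mpol" where
  "succ_Var r v = (case v of (a, b, c) \<Rightarrow> if c < r a then Var (a, b, Suc c) else 0)"

lemma J_mat_mult_x_vec:
  fixes lam :: "'a::field"
  shows "map_mat Const (J_mat lam l k r) *\<^sub>v x_vec l k r =
    vec_of_list (map (\<lambda>v. Const lam * Var v + succ_Var r v) (Lam_list l k r))"
proof -
  \<comment> \<open>One entry per Jordan block, in lexicographic order. Positions inside a block
    count from 0 but the third index counts from 1, hence \<open>Suc c\<close>.\<close>
  define bs :: "(nat \<times> (nat \<Rightarrow> idx)) list" where
    "bs = concat (map (\<lambda>a. map (\<lambda>b. (r a, \<lambda>c. (a, b, Suc c))) [1..<Suc (k a)]) [1..<Suc l])"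
  define bs' :: "(nat \<times> (nat \<Rightarrow> (idx, 'a) mpol)) list" where
    "bs' = map (\<lambda>(n, f). (n, \<lambda>c. Var (f c))) bs"
  have Suc_upt: "[1..<Suc n] = map Suc [0..<n]" for n
    by (simp add: map_Suc_upt del: upt_Suc)
  have concat_concat: "concat (concat xss) = concat (map concat xss)" for xss :: "idx list list list"
    by (induction xss) simp_all
  have Lam: "Lam_list l k r = concat (map (\<lambda>(n, f). map f [0..<n]) bs)"
    unfolding Lam_list_def bs_def Suc_upt[of "r _"]
    by (simp add: map_concat concat_concat o_def del: upt_Suc)
  have J: "concat (map (\<lambda>i. replicate (k i) (r i, lam)) [1..<Suc l]) = map (\<lambda>(n, f). (n, lam)) bs"
    unfolding bs_def by (simp add: map_concat o_def map_replicate_const del: upt_Suc)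
  have 1: "map_mat Const (J_mat lam l k r) =
      jordan_matrix (map (\<lambda>(n, f). (n, Const lam :: (idx, 'a) mpol)) bs')"
    unfolding J_mat_def J bs'_def
    by (subst map_mat_jordan_matrix) (simp_all add: o_def case_prod_unfold)
  have 2: "map Var (Lam_list l k r) = concat (map (\<lambda>(n, f). map f [0..<n]) bs')"
    unfolding Lam bs'_def by (simp add: map_concat o_def case_prod_unfold)
  have "(\<lambda>(n, f). map (\<lambda>c. Const lam * f c + (if Suc c < n then f (Suc c) else 0)) [0..<n])
        (case x of (n, f) \<Rightarrow> (n, \<lambda>c. Var (f c) :: (idx, 'a) mpol)) =
      map (\<lambda>v. Const lam * Var v + succ_Var r v) (case x of (n, f) \<Rightarrow> map f [0..<n])"
    if "x \<in> set bs" for x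
    using that unfolding bs_def by (auto simp: succ_Var_def)
  then have 3: "concat (map (\<lambda>(n, f).
      map (\<lambda>c. Const lam * f c + (if Suc c < n then f (Suc c) else 0)) [0..<n]) bs') =
      map (\<lambda>v. Const lam * Var v + succ_Var r v) (Lam_list l k r)"
    unfolding Lam bs'_def map_concat by (simp add: o_def cong: map_cong)
  show ?thesis
    unfolding x_vec_def 1 2 jordan_matrix_mult_vec 3 ..
qed

lemma Jx_x_mat_index:
  fixes lam :: "'a::field"
  assumes "i < length (Lam_list l k r)"
  shows "Jx_x_mat lam l k r $$ (i, 0) =
      Const lam * Var (Lam_list l k r ! i) + succ_Var r (Lam_list l k r ! i)"
    and "Jx_x_mat lam l k r $$ (i, 1) = Var (Lam_list l k r ! i)"
proof -
  have "Jx_x_mat lam l k r $$ (i, 0) = (map_mat Const (J_mat lam l k r) *\<^sub>v x_vec l k r) $ i"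
    using assms by (simp add: Jx_x_mat_def mat_of_cols_index)
  then show "Jx_x_mat lam l k r $$ (i, 0) =
      Const lam * Var (Lam_list l k r ! i) + succ_Var r (Lam_list l k r ! i)"
    using assms unfolding J_mat_mult_x_vec by (simp add: vec_of_list_index del: vec_of_list_map)
  show "Jx_x_mat lam l k r $$ (i, 1) = Var (Lam_list l k r ! i)"
    using assms
    by (simp add: Jx_x_mat_def mat_of_cols_index x_vec_def vec_of_list_index del: vec_of_list_map)
qed

lemma det_submatrix_2:
  fixes M :: "'b::comm_ring_1 mat"
  assumes "p < q" "q < dim_row M" "dim_col M = 2"
  shows "det (submatrix M {p, q} {0, 1}) = M $$ (p, 0) * M $$ (q, 1) - M $$ (p, 1) * M $$ (q, 0)"
proof -
  have "{i. i < dim_row M \<and> i \<in> {p, q}} = {p, q}" "{i. i < dim_col M \<and> i \<in> {0, 1}} = {0, 1}"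
    using assms by auto
  then have card: "card {i. i < dim_row M \<and> i \<in> {p, q}} = 2" "card {i. i < dim_col M \<and> i \<in> {0, 1}} = 2"
    using assms by simp_all
  have pick: "pick {a, b} 0 = a" "pick {a, b} 1 = b" if "a < b" for a b :: nat
  proof -
    show *: "pick {a, b} 0 = a" using that by (auto intro!: Least_equality)
    show "pick {a, b} 1 = b"
      unfolding One_nat_def pick.simps(2) * using that by (auto intro!: Least_equality)
  qed
  have "submatrix M {p, q} {0, 1} \<in> carrier_mat 2 2"
    by (rule carrier_matI) (simp_all only: dim_submatrix card)
  moreover have "submatrix M {p, q} {0, 1} $$ (i, j) = M $$ (pick {p, q} i, pick {0, 1} j)"
    if "i < 2" "j < 2" for i j
    by (rule submatrix_index) (simp_all only: card that)
  ultimately show ?thesis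
    using pick[OF assms(1)] pick[of 0 1] by (simp add: det_carrier_2)
qed

text \<open>The column set is forced to be both columns, so only the pair of rows is free; writing
  it as \<open>p < q\<close> fixes the sign.\<close>

lemma minors_2_two_columns:
  fixes M :: "'b::comm_ring_1 mat"
  assumes "dim_col M = 2"
  shows "minors 2 M =
    {M $$ (p, 0) * M $$ (q, 1) - M $$ (p, 1) * M $$ (q, 0) | p q. p < q \<and> q < dim_row M}"
proof (intro equalityI subsetI)
  fix x assume "x \<in> minors 2 M"
  then obtain I J where IJ: "x = det (submatrix M I J)" "I \<subseteq> {..<dim_row M}" "card I = 2"
      "J \<subseteq> {..<2}" "card J = 2"
    unfolding minors_def assms by blast
  have "J = {..<2}"
    using IJ(4,5) by (intro card_subset_eq) auto
  then have J: "J = {0, 1}" by auto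
  obtain a b where ab: "I = {a, b}" "a \<noteq> b"
    using IJ(3) by (meson card_2_iff)
  obtain p q where pq: "I = {p, q}" "p < q"
    using ab by (metis insert_commute linorder_neqE_nat)
  have "q < dim_row M"
    using IJ(2) pq by auto
  with pq show "x \<in> {M $$ (p, 0) * M $$ (q, 1) - M $$ (p, 1) * M $$ (q, 0) | p q. p < q \<and> q < dim_row M}"
    using det_submatrix_2[OF pq(2) _ assms] IJ(1) J by auto
next
  fix x assume "x \<in> {M $$ (p, 0) * M $$ (q, 1) - M $$ (p, 1) * M $$ (q, 0) | p q. p < q \<and> q < dim_row M}"
  then obtain p q where pq: "x = M $$ (p, 0) * M $$ (q, 1) - M $$ (p, 1) * M $$ (q, 0)"
      "p < q" "q < dim_row M"
    by blast
  have "x = det (submatrix M {p, q} {0, 1})"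
    using det_submatrix_2[OF pq(2,3) assms] pq(1) by simp
  moreover have "{p, q} \<subseteq> {..<dim_row M}" "card {p, q} = 2" "{0, 1} \<subseteq> {..<dim_col M}" "card {0::nat, 1} = 2"
    using pq assms by auto
  ultimately show "x \<in> minors 2 M"
    unfolding minors_def by blast
qed

text \<open>The eigenvalue cancels in the minors, so that only the nilpotent part of the matrix matters.\<close>

lemma minors_Jx_x_mat:
  fixes lam :: "'a::field"
  shows "minors 2 (Jx_x_mat lam l k r) =
    {succ_Var r (Lam_list l k r ! p) * Var (Lam_list l k r ! q) -
      Var (Lam_list l k r ! p) * succ_Var r (Lam_list l k r ! q) | p q.
      p < q \<and> q < length (Lam_list l k r)}"
proof -
  let ?M = "Jx_x_mat lam l k r"
  have dims: "dim_row ?M = length (Lam_list l k r)" "dim_col ?M = 2"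
    by (simp_all add: Jx_x_mat_def)
  have "?M $$ (p, 0) * ?M $$ (q, 1) - ?M $$ (p, 1) * ?M $$ (q, 0) =
      succ_Var r (Lam_list l k r ! p) * Var (Lam_list l k r ! q) -
      Var (Lam_list l k r ! p) * succ_Var r (Lam_list l k r ! q)"
    if "p < q" "q < length (Lam_list l k r)" for p q
  proof -
    have p: "p < length (Lam_list l k r)" using that by simp
    show ?thesis
      unfolding Jx_x_mat_index[OF p] Jx_x_mat_index[OF that(2)] by (simp add: algebra_simps)
  qed
  then show ?thesis
    unfolding minors_2_two_columns[OF dims(2)] dims(1) by (metis (no_types, lifting))
qed

section \<open>The ideal as the kernel of a monomial substitution\<close>

lemma poly_mapping_split_single:
  fixes m :: "'v \<Rightarrow>\<^sub>0 nat"
  assumes "v \<in> Poly_Mapping.keys m"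
  obtains m' where "m = Poly_Mapping.single v 1 + m'"
proof
  show "m = Poly_Mapping.single v 1 + (m - Poly_Mapping.single v 1)"
    using assms
    by (intro poly_mapping_eqI) (auto simp: lookup_add lookup_minus lookup_single when_def in_keys_iff)
qed

lemma monomial_add: "monomial (a + b) = monomial a * monomial b"
  by (simp add: mult_single)

locale jordan_component =
  fixes lam :: "'a::field" and l :: nat and k r :: "nat \<Rightarrow> nat" and j :: nat
  assumes k_pos: "i \<in> {1..l} \<Longrightarrow> k i > 0"
    and r_pos: "i \<in> {1..l} \<Longrightarrow> r i > 0"
    and r_antimono: "strict_antimono_on {1..l} r"
    and j_range: "j \<in> {1..l}"
begin

abbreviation "V \<equiv> Lam l k r"
abbreviation "R \<equiv> mpoly_ring V :: (idx, 'a) mpol ring"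
abbreviation "q \<equiv> q_ideal lam l k r j"

lemma r_ge: "i \<in> {1..j} \<Longrightarrow> r j \<le> r i"
  using monotone_onD[OF r_antimono, of i j] j_range by (cases "i = j") auto

lemma r_j_pos: "r j > 0"
  using r_pos j_range by blast

text \<open>
  The class of a monomial is its image under \<open>x(a,b,c) \<mapsto> s ^ (c - 1) z(a,b)\<close>: the exponents of the
  \<open>z(a,b)\<close>, and the exponent of \<open>s\<close> as its weight. The blocks with \<open>a > j\<close> get weights at least \<open>r j\<close>,
  since their variables have to vanish.
\<close>

definition block :: "idx \<Rightarrow> nat \<times> nat" where
  "block v = (case v of (a, b, c) \<Rightarrow> (a, b))"

definition weight :: "idx \<Rightarrow> nat" where
  "weight v = (case v of (a, b, c) \<Rightarrow> c - 1 + (if a > j then r j else 0))"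

definition mon_class :: "(idx \<Rightarrow>\<^sub>0 nat) \<Rightarrow> ((nat \<times> nat) \<Rightarrow>\<^sub>0 nat) \<times> nat" where
  "mon_class m = (\<Sum>v\<in>Poly_Mapping.keys m.
     (Poly_Mapping.single (block v) (Poly_Mapping.lookup m v), Poly_Mapping.lookup m v * weight v))"

text \<open>For \<open>\<mu> = (D, n)\<close>, the coefficient in the image of \<open>f\<close> at
  \<open>s ^ n\<close> times the monomial in the \<open>z(a,b)\<close> with exponents
  \<open>D\<close>. The monoid algebra of such pairs is the polynomial ring in \<open>s\<close> and
  the \<open>z(a,b)\<close>.\<close>

definition class_coeff :: "(idx, 'a) mpol \<Rightarrow> ((nat \<times> nat) \<Rightarrow>\<^sub>0 nat) \<times> nat \<Rightarrow> 'a" where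
  "class_coeff f = Poly_Mapping.lookup (linear_extension (\<lambda>m. Poly_Mapping.single (mon_class m) 1) f)"

text \<open>Reduction modulo \<open>s ^ r j\<close> amounts to forgetting the coefficients with
  \<open>snd \<mu> \<ge> r j\<close>, so that no quotient ring has to be formed.\<close>

definition kernel :: "(idx, 'a) mpol set" where
  "kernel = {f \<in> carrier R. \<forall>\<mu>. snd \<mu> < r j \<longrightarrow> class_coeff f \<mu> = 0}"

lemma kernelD: "f \<in> kernel \<Longrightarrow> snd \<mu> < r j \<Longrightarrow> class_coeff f \<mu> = 0"
  unfolding kernel_def by blast

lemma mon_class_0 [simp]: "mon_class 0 = 0"
  by (simp add: mon_class_def)

lemma mon_class_add: "mon_class (m + m') = mon_class m + mon_class m'"
  unfolding mon_class_def
  by (rule setsum_keys_plus_distrib) (simp_all add: single_add distrib_right zero_prod_def)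

lemma mon_class_single: "mon_class (Poly_Mapping.single v n) = (Poly_Mapping.single (block v) n, n * weight v)"
  by (cases "n = 0") (simp_all add: mon_class_def zero_prod_def)

lemma fst_mon_class:
  "fst (mon_class m) = (\<Sum>v\<in>Poly_Mapping.keys m. Poly_Mapping.single (block v) (Poly_Mapping.lookup m v))"
  by (simp add: mon_class_def fst_sum)

lemma snd_mon_class:
  "snd (mon_class m) = (\<Sum>v\<in>Poly_Mapping.keys m. Poly_Mapping.lookup m v * weight v)"
  by (simp add: mon_class_def snd_sum)

lemma mon_degree_mon_class: "mon_degree (fst (mon_class m)) = mon_degree m"
proof -
  have "mon_degree (sum f A) = (\<Sum>x\<in>A. mon_degree (f x))" for f :: "idx \<Rightarrow> nat \<times> nat \<Rightarrow>\<^sub>0 nat" and A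
    by (induction A rule: infinite_finite_induct) (simp_all add: mon_degree_add)
  then show ?thesis
    by (simp add: fst_mon_class) (simp add: mon_degree_def)
qed

lemma keys_mon_class: "Poly_Mapping.keys (fst (mon_class m)) = block ` Poly_Mapping.keys m"
proof -
  have "Poly_Mapping.keys (sum f A) = (\<Union>x\<in>A. Poly_Mapping.keys (f x))"
    if "finite A" for f :: "idx \<Rightarrow> nat \<times> nat \<Rightarrow>\<^sub>0 nat" and A
    using that by (induction A) (simp_all add: keys_add_nat)
  then show ?thesis
    by (auto simp: fst_mon_class in_keys_iff)
qed

lemma weight_le_mon_class: "v \<in> Poly_Mapping.keys m \<Longrightarrow> weight v \<le> snd (mon_class m)"
  by (elim poly_mapping_split_single) (simp add: mon_class_add mon_class_single)

lemma class_coeff_single: "class_coeff (Poly_Mapping.single m c) \<mu> = (c when mon_class m = \<mu>)"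
  by (simp add: class_coeff_def linear_extension_single mult_single lookup_single)

lemma class_coeff_add: "class_coeff (f + g) \<mu> = class_coeff f \<mu> + class_coeff g \<mu>"
  and class_coeff_diff: "class_coeff (f - g) \<mu> = class_coeff f \<mu> - class_coeff g \<mu>"
  and class_coeff_Const_mult: "class_coeff (Const c * f) \<mu> = c * class_coeff f \<mu>"
  and class_coeff_sum: "class_coeff (\<Sum>x\<in>A. F x) \<mu> = (\<Sum>x\<in>A. class_coeff (F x) \<mu>)"
  and class_coeff_0 [simp]: "class_coeff 0 \<mu> = 0"
  by (simp_all add: class_coeff_def linear_extension_add linear_extension_diff lookup_sum
      linear_extension_Const_mult linear_extension_sum lookup_add lookup_minus lookup_single_zero_mult)

lemma class_coeff_eq:
  "class_coeff f \<mu> = (\<Sum>m\<in>{m \<in> Poly_Mapping.keys f. mon_class m = \<mu>}. Poly_Mapping.lookup f m)"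
proof -
  have "class_coeff f \<mu> = (\<Sum>m\<in>Poly_Mapping.keys f. Poly_Mapping.lookup f m when mon_class m = \<mu>)"
    by (subst poly_mapping_eq_sum_single[of f]) (simp only: class_coeff_sum class_coeff_single)
  also have "\<dots> = (\<Sum>m\<in>{m \<in> Poly_Mapping.keys f. mon_class m = \<mu>}. Poly_Mapping.lookup f m)"
    by (rule sum.mono_neutral_cong_right) (auto simp: when_def)
  finally show ?thesis .
qed

lemma class_coeff_nonzeroE:
  assumes "class_coeff f \<mu> \<noteq> 0"
  obtains m where "m \<in> Poly_Mapping.keys f" "mon_class m = \<mu>"
  using assms unfolding class_coeff_eq
  by (metis (mono_tags, lifting) mem_Collect_eq sum.not_neutral_contains_not_neutral)

text \<open>The exponent of \<open>s\<close> in a product is the sum of the exponents in the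
  factors. A term of the image of \<open>g * f\<close> below \<open>r j\<close> thus involves a term
  of the image of \<open>f\<close> below \<open>r j\<close>, and there are none.\<close>

lemma ideal_kernel: "ideal kernel R"
proof (rule ideal_mpoly_ringI)
  fix f g assume f: "f \<in> kernel" and g: "g \<in> carrier R"
  let ?E = "linear_extension (\<lambda>m. Poly_Mapping.single (mon_class m) (1::'a))"
  have "class_coeff (g * f) \<mu> = 0" if "snd \<mu> < r j" for \<mu>
  proof (rule ccontr)
    assume "class_coeff (g * f) \<mu> \<noteq> 0"
    then have "\<mu> \<in> Poly_Mapping.keys (?E (g * f))"
      by (simp add: class_coeff_def in_keys_iff)
    moreover have "?E (g * f) = ?E g * ?E f"
      by (rule linear_extension_mult) (simp add: mon_class_add mult_single)
    ultimately obtain \<alpha> \<beta> where "\<mu> = \<alpha> + \<beta>" and \<beta>: "\<beta> \<in> Poly_Mapping.keys (?E f)"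
      using keys_mult[of "?E g" "?E f"] by auto
    then have "snd \<beta> < r j"
      using that by simp
    then have "class_coeff f \<beta> = 0"
      by (rule kernelD[OF f])
    with \<beta> show False
      by (simp add: class_coeff_def in_keys_iff)
  qed
  with f g show "g * f \<in> kernel"
    by (simp add: kernel_def)
qed (auto simp: kernel_def class_coeff_add)

lemma Lam_iff: "(a, b, c) \<in> V \<longleftrightarrow> a \<in> {1..l} \<and> b \<in> {1..k a} \<and> c \<in> {1..r a}"
  by (simp add: Lam_def)

lemma Var_mult_Var: "Var v * Var w = Poly_Mapping.single (Poly_Mapping.single v 1 + Poly_Mapping.single w 1) 1"
  by (simp add: Var_def mult_single)

text \<open>Away from the end of a block the successor has the same block and one more unit of
  weight. At the end the left side is 0, while the class on the right has weight at least
  \<open>r j\<close> and so differs from \<open>\<mu>\<close>: for \<open>a \<le> j\<close> because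
  \<open>r a \<ge> r j\<close>, for \<open>a > j\<close> because of the extra \<open>r j\<close> in
  the weight. The right side is symmetric in \<open>v\<close> and \<open>w\<close>, which is why the
  minors lie in the kernel.\<close>

lemma class_coeff_succ_Var_mult:
  assumes "v \<in> V" and "snd \<mu> < r j"
  shows "class_coeff (succ_Var r v * Var w) \<mu> =
    (1 when (Poly_Mapping.single (block v) 1 + Poly_Mapping.single (block w) 1,
      Suc (weight v + weight w)) = \<mu>)"
proof -
  obtain a b c where v: "v = (a, b, c)" by (cases v)
  show ?thesis
  proof (cases "c < r a")
    case True
    have "block (a, b, Suc c) = block v" "weight (a, b, Suc c) = Suc (weight v)"
      using assms(1) by (auto simp: v block_def weight_def Lam_iff)
    then show ?thesis
      using True by (simp add: v succ_Var_def Var_mult_Var class_coeff_single mon_class_add mon_class_single)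
  next
    case False
    then have "c = r a" "c \<ge> 1"
      using assms(1) by (auto simp: v Lam_iff)
    moreover have "r j \<le> r a" if "a \<le> j"
      using r_ge[of a] that assms(1) by (auto simp: v Lam_iff)
    ultimately have "Suc (weight v) \<ge> r j"
      by (auto simp: v weight_def)
    then show ?thesis
      using False assms(2) by (auto simp: v succ_Var_def when_def)
  qed
qed

lemma Var_in_q_generators: "Var ` (Lam1 l k r j \<union> Lam2 l k r j) \<subseteq> carrier R"
  using Var_in_carrier by (fastforce simp: Lam1_def Lam2_def)

lemma succ_Var_in_carrier: "v \<in> V \<Longrightarrow> succ_Var r v \<in> carrier R"
  by (auto simp: succ_Var_def Lam_iff intro!: Var_in_carrier split: prod.split)

lemma minors_subset:
  "minors 2 (Jx_x_mat lam l k r) \<subseteq> {succ_Var r v * Var w - Var v * succ_Var r w | v w. v \<in> V \<and> w \<in> V}"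
proof
  fix f assume "f \<in> minors 2 (Jx_x_mat lam l k r)"
  then obtain p q where "p < q" "q < length (Lam_list l k r)"
      and f: "f = succ_Var r (Lam_list l k r ! p) * Var (Lam_list l k r ! q) -
        Var (Lam_list l k r ! p) * succ_Var r (Lam_list l k r ! q)"
    unfolding minors_Jx_x_mat by blast
  then have "Lam_list l k r ! p \<in> V" "Lam_list l k r ! q \<in> V"
    using nth_mem[of _ "Lam_list l k r"] by (simp_all add: set_Lam_list)
  with f show "f \<in> {succ_Var r v * Var w - Var v * succ_Var r w | v w. v \<in> V \<and> w \<in> V}"
    by blast
qed

lemma minors_in_carrier: "minors 2 (Jx_x_mat lam l k r) \<subseteq> carrier R"
proof
  fix f assume "f \<in> minors 2 (Jx_x_mat lam l k r)"
  then obtain v w where "v \<in> V" "w \<in> V" "f = succ_Var r v * Var w - Var v * succ_Var r w"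
    using minors_subset by blast
  then show "f \<in> carrier R"
    by (simp add: succ_Var_in_carrier Var_in_carrier)
qed

lemma ideal_I_lam: "ideal (I_lam lam l k r) R"
  and minors_in_I_lam: "minors 2 (Jx_x_mat lam l k r) \<subseteq> I_lam lam l k r"
  and ideal_I_sub: "ideal (I_sub l k r j) R"
  and Var_in_I_sub: "Var ` (Lam1 l k r j \<union> Lam2 l k r j) \<subseteq> (I_sub l k r j :: (idx, 'a) mpol set)"
  unfolding I_lam_def I_sub_def
  by (rule genideal_mpoly_ring, rule minors_in_carrier Var_in_q_generators)+

lemma ideal_q: "ideal q R"
  unfolding q_ideal_def by (rule sum_ideals_mpoly_ring(1)[OF ideal_I_lam ideal_I_sub])

lemma q_subset_kernel: "q \<subseteq> kernel"
proof -
  have "f \<in> kernel" if f_minor: "f \<in> minors 2 (Jx_x_mat lam l k r)" for f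
  proof -
    obtain v w where vw: "v \<in> V" "w \<in> V" and f: "f = succ_Var r v * Var w - Var v * succ_Var r w"
      using minors_subset f_minor by blast
    have "class_coeff f \<mu> = 0" if "snd \<mu> < r j" for \<mu>
      unfolding f mult.commute[of "Var v"] class_coeff_diff
        class_coeff_succ_Var_mult[OF vw(1) that] class_coeff_succ_Var_mult[OF vw(2) that]
      by (simp add: add.commute)
    moreover have "f \<in> carrier R"
      using f_minor minors_in_carrier by blast
    ultimately show ?thesis
      by (simp add: kernel_def)
  qed
  then have 1: "I_lam lam l k r \<subseteq> kernel"
    unfolding I_lam_def by (intro genideal_mpoly_ring_le ideal_kernel) blast
  have "Var v \<in> kernel" if v: "v \<in> Lam1 l k r j \<union> Lam2 l k r j" for v
  proof -
    have "weight v \<ge> r j"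
      using v by (auto simp: Lam1_def Lam2_def weight_def)
    then have "class_coeff (Var v) \<mu> = 0" if "snd \<mu> < r j" for \<mu>
      using that by (auto simp: Var_def class_coeff_single mon_class_single when_def)
    moreover have "Var v \<in> carrier R"
      using v Var_in_q_generators by blast
    ultimately show ?thesis
      by (simp add: kernel_def)
  qed
  then have 2: "I_sub l k r j \<subseteq> kernel"
    unfolding I_sub_def by (intro genideal_mpoly_ring_le ideal_kernel) blast
  show ?thesis
    unfolding q_ideal_def
    by (rule sum_ideals_mpoly_ring(3)[OF ideal_I_lam ideal_I_sub ideal_kernel 1 2])
qed

text \<open>The minors provide only pairs of rows in increasing order; the relation is 0 for equal
  rows and changes sign when they are swapped.\<close>

lemma relation_in_q:
  assumes "v \<in> V" and "w \<in> V"
  shows "succ_Var r v * Var w - Var v * succ_Var r w \<in> q"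
proof -
  have minors: "minors 2 (Jx_x_mat lam l k r) \<subseteq> q"
    unfolding q_ideal_def
    using minors_in_I_lam sum_ideals_mpoly_ring(2)[OF ideal_I_lam ideal_I_sub] by blast
  obtain m n where mn: "v = Lam_list l k r ! m" "m < length (Lam_list l k r)"
      "w = Lam_list l k r ! n" "n < length (Lam_list l k r)"
    using assms unfolding set_Lam_list[symmetric] in_set_conv_nth by metis
  consider "m < n" | "m = n" | "n < m" by linarith
  then show ?thesis
  proof cases
    case 1
    with mn minors show ?thesis
      unfolding minors_Jx_x_mat by blast
  next
    case 2
    with mn show ?thesis
      by (simp add: mult.commute ideal_mpoly_ringD(2)[OF ideal_q])
  next
    case 3
    with mn minors have "succ_Var r w * Var v - Var w * succ_Var r v \<in> q"
      unfolding minors_Jx_x_mat by blast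
    from ideal_mpoly_ringD(4)[OF ideal_q this] show ?thesis
      by (simp add: mult.commute)
  qed
qed

section \<open>Straightening monomials modulo the ideal\<close>

definition good :: "idx set" where
  "good = {(a, b, c). a \<in> {1..j} \<and> b \<in> {1..k a} \<and> c \<in> {1..r j}}"

lemma goodE:
  assumes "v \<in> good"
  obtains a b e where "v = (a, b, Suc e)" "a \<in> {1..j}" "b \<in> {1..k a}" "e < r j" "block v = (a, b)" "weight v = e"
proof -
  obtain a b c where v: "v = (a, b, c)" by (cases v)
  then obtain e where "c = Suc e"
    using assms by (cases c) (auto simp: good_def)
  with assms v show thesis
    by (intro that) (auto simp: good_def block_def weight_def)
qed

lemma good_subset: "good \<subseteq> V"
proof
  fix v assume "v \<in> good"
  then show "v \<in> V"
    using r_ge j_range by (elim goodE) (force simp: Lam_iff)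
qed

text \<open>\<open>good\<close> is the complement of the two index sets whose variables generate the
  second summand of \<open>q\<close>.\<close>

lemma Var_in_q: "v \<in> V \<Longrightarrow> v \<notin> good \<Longrightarrow> Var v \<in> q"
proof -
  assume v: "v \<in> V" "v \<notin> good"
  have "v \<in> Lam1 l k r j \<union> Lam2 l k r j"
    using v by (cases v) (auto simp: good_def Lam1_def Lam2_def Lam_iff)
  then show ?thesis
    unfolding q_ideal_def
    using Var_in_I_sub sum_ideals_mpoly_ring(2)[OF ideal_I_lam ideal_I_sub] by blast
qed

lemma weight_not_good: "v \<in> V \<Longrightarrow> v \<notin> good \<Longrightarrow> weight v \<ge> r j"
  by (cases v) (auto simp: good_def weight_def Lam_iff)

text \<open>The lift of weight 0: each \<open>z(a,b)\<close> is replaced by the first variable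
  \<open>x(a,b,1)\<close> of its block.\<close>

definition base_monomial :: "((nat \<times> nat) \<Rightarrow>\<^sub>0 nat) \<Rightarrow> (idx \<Rightarrow>\<^sub>0 nat)" where
  "base_monomial D = (\<Sum>i\<in>Poly_Mapping.keys D. Poly_Mapping.single (fst i, snd i, 1) (Poly_Mapping.lookup D i))"

lemma base_monomial_add: "base_monomial (D + E) = base_monomial D + base_monomial E"
  unfolding base_monomial_def by (rule setsum_keys_plus_distrib) (simp_all add: single_add)

lemma base_monomial_single: "base_monomial (Poly_Mapping.single i n) = Poly_Mapping.single (fst i, snd i, 1) n"
  by (cases "n = 0") (simp_all add: base_monomial_def)

lemma base_monomial_sum: "base_monomial (\<Sum>x\<in>A. f x) = (\<Sum>x\<in>A. base_monomial (f x))"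
  by (induction A rule: infinite_finite_induct) (simp_all add: base_monomial_add, simp_all add: base_monomial_def)

text \<open>Weight 0 forces every factor to be the first variable of its block, and such a monomial
  can be read off from its block exponents.\<close>

lemma base_monomial_mon_class:
  assumes "Poly_Mapping.keys m \<subseteq> good" and "snd (mon_class m) = 0"
  shows "base_monomial (fst (mon_class m)) = m"
proof -
  have "base_monomial (fst (mon_class m)) =
      (\<Sum>v\<in>Poly_Mapping.keys m. Poly_Mapping.single (fst (block v), snd (block v), 1) (Poly_Mapping.lookup m v))"
    by (simp add: fst_mon_class base_monomial_sum base_monomial_single)
  also have "\<dots> = (\<Sum>v\<in>Poly_Mapping.keys m. Poly_Mapping.single v (Poly_Mapping.lookup m v))"
  proof (rule sum.cong)
    fix v assume v: "v \<in> Poly_Mapping.keys m"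
    then have "weight v = 0" "v \<in> good"
      using weight_le_mon_class[OF v] assms by auto
    then have "(fst (block v), snd (block v), 1) = v"
      by (cases v) (auto simp: good_def weight_def block_def)
    then show "Poly_Mapping.single (fst (block v), snd (block v), 1) (Poly_Mapping.lookup m v) =
        Poly_Mapping.single v (Poly_Mapping.lookup m v)"
      by simp
  qed simp
  also have "\<dots> = m"
    by (rule poly_mapping_eq_sum_single[symmetric])
  finally show ?thesis .
qed

text \<open>All the weight of a monomial can be moved to one chosen variable.\<close>

lemma straighten:
  assumes "(a, b, Suc e) \<in> good" and "Poly_Mapping.keys m \<subseteq> good"
  shows "Var (a, b, Suc e) * monomial m -
    (if e + snd (mon_class m) < r j then Var (a, b, Suc (e + snd (mon_class m))) else 0) *
      monomial (base_monomial (fst (mon_class m))) \<in> q"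
  using assms
\<comment> \<open>Each step moves one unit of weight from \<open>m\<close> to the chosen variable,
  so \<open>e\<close> has to grow while the weight of \<open>m\<close> drops.\<close>
proof (induction "snd (mon_class m)" arbitrary: e m)
  case 0
  then have "e < r j" by (simp add: good_def)
  then show ?case
    using base_monomial_mon_class[of m] 0 ideal_mpoly_ringD(2)[OF ideal_q] by simp
next
  case (Suc n)
  let ?u = "(a, b, Suc e)"
  have "\<exists>v\<in>Poly_Mapping.keys m. weight v \<noteq> 0"
  proof (rule ccontr)
    assume "\<not> (\<exists>v\<in>Poly_Mapping.keys m. weight v \<noteq> 0)"
    then have "snd (mon_class m) = 0" by (simp add: snd_mon_class)
    with Suc.hyps(2) show False by simp
  qed
  then obtain v where v: "v \<in> Poly_Mapping.keys m" "weight v \<noteq> 0" by blast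
  obtain m1 where m: "m = Poly_Mapping.single v 1 + m1"
    using poly_mapping_split_single[OF v(1)] .
  obtain a' b' c' where v_eq: "v = (a', b', c')" by (cases v)
  \<comment> \<open>The predecessor of \<open>v\<close> in its block, which exists because
    \<open>v\<close> has positive weight.\<close>
  define w where "w = (a', b', c' - 1)"
  have v_good: "v \<in> good" using v(1) Suc.prems(2) by blast
  have c': "c' \<ge> 2" "a' \<le> j"
    using v_good v(2) v_eq by (auto simp: good_def weight_def)
  have "c' \<le> r a'"
    using v_good good_subset v_eq Lam_iff by auto
  note c' = c' this
  have w: "w \<in> good" "block w = block v" "weight v = Suc (weight w)" "succ_Var r w = Var v"
    using v_good c' by (auto simp: v_eq w_def good_def block_def weight_def succ_Var_def)
  define m2 where "m2 = Poly_Mapping.single w 1 + m1"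
  have "snd (mon_class m) = Suc (snd (mon_class m2))" "fst (mon_class m2) = fst (mon_class m)"
    by (simp_all add: m m2_def mon_class_add mon_class_single w(2,3))
  moreover have "n = snd (mon_class m2)"
    using Suc.hyps(2) calculation by simp
  moreover have m2_good: "Poly_Mapping.keys m2 \<subseteq> good"
    using Suc.prems(2) w(1) by (simp add: m m2_def keys_add_nat)
  ultimately have IH: "Var (a, b, Suc (Suc e)) * monomial m2 -
      (if e + snd (mon_class m) < r j then Var (a, b, Suc (e + snd (mon_class m))) else 0) *
        monomial (base_monomial (fst (mon_class m))) \<in> q"
    if "(a, b, Suc (Suc e)) \<in> good"
    using Suc.hyps(1)[of m2 "Suc e"] that by (simp split: if_splits)
  have u: "?u \<in> V" using Suc.prems(1) good_subset by blast
  \<comment> \<open>Multiplied by the remaining factors \<open>m1\<close>, the relation for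
    \<open>?u\<close> and \<open>w\<close> trades the product of \<open>?u\<close> and
    \<open>v\<close> for that of the successor of \<open>?u\<close> and \<open>w\<close>.\<close>
  have "monomial m1 * (succ_Var r ?u * Var w - Var ?u * succ_Var r w) \<in> q"
    using Suc.prems(2) w(1) good_subset u
    by (intro ideal_mpoly_ringD(6)[OF ideal_q relation_in_q] single_in_carrier) (auto simp: m keys_add_nat)
  then have "succ_Var r ?u * monomial m2 - Var ?u * monomial m \<in> q"
    by (simp add: w(4) m m2_def monomial_add Var_def algebra_simps)
  from ideal_mpoly_ringD(4)[OF ideal_q this]
  have step: "Var ?u * monomial m - succ_Var r ?u * monomial m2 \<in> q" by simp
  show ?case
  proof (cases "Suc e < r j")
    case True
    then have *: "(a, b, Suc (Suc e)) \<in> good" "succ_Var r ?u = Var (a, b, Suc (Suc e))"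
      using Suc.prems(1) r_ge[of a] by (auto simp: good_def succ_Var_def)
    then show ?thesis
      using ideal_mpoly_ringD(3)[OF ideal_q step IH[OF *(1)]]
      by (simp only: *(2) add_diff_eq diff_add_cancel)
  next
    case False
    \<comment> \<open>The chosen variable cannot be shifted further modulo \<open>q\<close>: its
      successor is either a generator of \<open>I_sub\<close> or past the end of the block, hence
      0.\<close>
    have "succ_Var r ?u \<in> q"
    proof (cases "Suc e < r a")
      case True
      have "(a, b, Suc (Suc e)) \<in> V" "(a, b, Suc (Suc e)) \<notin> good"
        using True False u by (auto simp: Lam_iff good_def)
      then show ?thesis
        using True Var_in_q by (simp add: succ_Var_def)
    next
      case False
      then show ?thesis
        using ideal_mpoly_ringD(2)[OF ideal_q] by (simp add: succ_Var_def)
    qed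
    then have "succ_Var r ?u * monomial m2 \<in> q"
      using ideal_mpoly_ringD(6)[OF ideal_q _ single_in_carrier, of "succ_Var r ?u" m2 1] m2_good good_subset
      by (auto simp: mult.commute)
    from ideal_mpoly_ringD(3)[OF ideal_q step this] have "Var ?u * monomial m \<in> q"
      by simp
    moreover have "\<not> e + snd (mon_class m) < r j"
      using False Suc.hyps(2) by simp
    ultimately show ?thesis by simp
  qed
qed

text \<open>A factor outside \<open>good\<close> is itself in \<open>q\<close>. Otherwise any factor
  can serve as the chosen variable, and the total shift is more than its block can hold modulo
  \<open>q\<close>, so the normal form is 0.\<close>

lemma monomial_in_q:
  assumes "Poly_Mapping.keys m \<subseteq> V" and "snd (mon_class m) \<ge> r j"
  shows "monomial m \<in> q"
proof (cases "Poly_Mapping.keys m \<subseteq> good")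
  case True
  have "m \<noteq> 0" using assms(2) r_j_pos by auto
  then obtain u where u: "u \<in> Poly_Mapping.keys m"
    by (metis all_not_in_conv in_keys_iff lookup_zero poly_mapping_eqI)
  obtain m1 where m: "m = Poly_Mapping.single u 1 + m1"
    using poly_mapping_split_single[OF u] .
  obtain a b e where u_eq: "u = (a, b, Suc e)" and "weight u = e"
    using u True by (meson goodE subsetD)
  then have "\<not> e + snd (mon_class m1) < r j"
    using assms(2) by (simp add: m mon_class_add mon_class_single)
  then show ?thesis
    using straighten[of a b e m1] True u by (simp add: m u_eq[symmetric] keys_add_nat monomial_add Var_def)
next
  case False
  then obtain v where v: "v \<in> Poly_Mapping.keys m" "v \<notin> good" by blast
  obtain m1 where m: "m = Poly_Mapping.single v 1 + m1"
    using poly_mapping_split_single[OF v(1)] .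
  have "monomial m1 * Var v \<in> q"
    using assms(1) v by (intro ideal_mpoly_ringD(6)[OF ideal_q Var_in_q] single_in_carrier) (auto simp: m keys_add_nat)
  then show ?thesis
    by (simp add: m monomial_add Var_def mult.commute)
qed

text \<open>Equal classes have equal sets of blocks, so in the case of small weight both monomials
  can be straightened onto variables of a common block. The normal form depends only on that block,
  the total weight and the remaining block exponents, which agree even if the two chosen variables
  have different weights.\<close>

lemma monomial_diff_in_q:
  assumes "Poly_Mapping.keys m \<subseteq> V" "Poly_Mapping.keys m' \<subseteq> V" and eq: "mon_class m = mon_class m'"
  shows "monomial m - monomial m' \<in> q"
proof (cases "snd (mon_class m) < r j")
  case False
  then show ?thesis
    using monomial_in_q[OF assms(1)] monomial_in_q[OF assms(2)] eq
    by (intro ideal_mpoly_ringD(5)[OF ideal_q]) auto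
next
  case True
  have good: "Poly_Mapping.keys m \<subseteq> good" "Poly_Mapping.keys m' \<subseteq> good"
    using assms(1,2) True eq weight_not_good weight_le_mon_class by fastforce+
  show ?thesis
  proof (cases "Poly_Mapping.keys m = {}")
    case True
    then have "Poly_Mapping.keys m' = {}"
      using keys_mon_class[of m] keys_mon_class[of m'] eq by simp
    with True have "m = m'"
      by (intro poly_mapping_eqI) (metis empty_iff in_keys_iff)
    then show ?thesis
      using ideal_mpoly_ringD(2)[OF ideal_q] by simp
  next
    case False
    then obtain u where u: "u \<in> Poly_Mapping.keys m" by blast
    have "block u \<in> block ` Poly_Mapping.keys m'"
      using u keys_mon_class[of m] keys_mon_class[of m'] eq by auto
    then obtain u' where u': "u' \<in> Poly_Mapping.keys m'" "block u' = block u" by auto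
    obtain a b e where u_eq: "u = (a, b, Suc e)" "block u = (a, b)" "weight u = e"
      using u good(1) by (meson goodE subsetD)
    obtain a' b' e' where "u' = (a', b', Suc e')" "block u' = (a', b')" "weight u' = e'"
      using u'(1) good(2) by (meson goodE subsetD)
    then have u'_eq: "u' = (a, b, Suc e')" "weight u' = e'"
      using u'(2) u_eq(2) by auto
    obtain m1 where m: "m = Poly_Mapping.single u 1 + m1"
      using poly_mapping_split_single[OF u] .
    obtain m1' where m': "m' = Poly_Mapping.single u' 1 + m1'"
      using poly_mapping_split_single[OF u'(1)] .
    have *: "fst (mon_class m1) = fst (mon_class m1')" "e + snd (mon_class m1) = e' + snd (mon_class m1')"
      using eq by (simp_all add: m m' mon_class_add mon_class_single u'(2) u_eq(3) u'_eq(2) prod_eq_iff)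
    have s: "Var u * monomial m1 -
        (if e + snd (mon_class m1) < r j then Var (a, b, Suc (e + snd (mon_class m1))) else 0) *
        monomial (base_monomial (fst (mon_class m1))) \<in> q"
      unfolding u_eq(1) by (rule straighten) (use good(1) u u_eq(1) in \<open>auto simp: m keys_add_nat\<close>)
    have s': "Var u' * monomial m1' -
        (if e' + snd (mon_class m1') < r j then Var (a, b, Suc (e' + snd (mon_class m1'))) else 0) *
        monomial (base_monomial (fst (mon_class m1'))) \<in> q"
      unfolding u'_eq(1) by (rule straighten) (use good(2) u' u'_eq(1) in \<open>auto simp: m' keys_add_nat\<close>)
    show ?thesis
      using ideal_mpoly_ringD(5)[OF ideal_q s s'] unfolding *
      by (simp only: m m' monomial_add Var_def[symmetric] diff_diff_eq2 diff_add_cancel)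
  qed
qed

text \<open>Replacing each monomial of \<open>f\<close> by a fixed representative of its class
  changes \<open>f\<close> by an element of \<open>q\<close>. Grouped by class, the result
  \<open>g\<close> has the coefficients \<open>class_coeff f\<close>: these vanish below weight
  \<open>r j\<close>, and the representatives from weight \<open>r j\<close> on lie in
  \<open>q\<close>.\<close>

theorem q_eq_kernel: "q = kernel"
proof (intro equalityI q_subset_kernel subsetI)
  fix f assume f: "f \<in> kernel"
  then have f_carrier: "f \<in> carrier R" by (simp add: kernel_def)
  define rep where "rep \<mu> = (SOME m. Poly_Mapping.keys m \<subseteq> V \<and> mon_class m = \<mu>)" for \<mu>
  have rep: "Poly_Mapping.keys (rep (mon_class m)) \<subseteq> V \<and> mon_class (rep (mon_class m)) = mon_class m"
    if "Poly_Mapping.keys m \<subseteq> V" for m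
    unfolding rep_def by (rule someI) (use that in simp)
  have keys: "Poly_Mapping.keys m \<subseteq> V" if "m \<in> Poly_Mapping.keys f" for m
    using f_carrier that by (simp add: in_carrier_mpoly_ring)
  define g where "g = (\<Sum>m\<in>Poly_Mapping.keys f. Const (Poly_Mapping.lookup f m) * monomial (rep (mon_class m)))"
  have "g = (\<Sum>\<mu>\<in>mon_class ` Poly_Mapping.keys f. \<Sum>m\<in>{m \<in> Poly_Mapping.keys f. mon_class m = \<mu>}.
      Const (Poly_Mapping.lookup f m) * monomial (rep (mon_class m)))"
    unfolding g_def by (rule sum.image_gen) simp
  also have "\<dots> = (\<Sum>\<mu>\<in>mon_class ` Poly_Mapping.keys f. Const (class_coeff f \<mu>) * monomial (rep \<mu>))"
  proof (rule sum.cong)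
    fix \<mu>
    have Const_sum: "Const (sum c A) = (\<Sum>x\<in>A. Const (c x))" for c :: "(idx \<Rightarrow>\<^sub>0 nat) \<Rightarrow> 'a" and A
      by (induction A rule: infinite_finite_induct) (simp_all add: Const_add)
    show "(\<Sum>m\<in>{m \<in> Poly_Mapping.keys f. mon_class m = \<mu>}.
        Const (Poly_Mapping.lookup f m) * monomial (rep (mon_class m))) =
        Const (class_coeff f \<mu>) * monomial (rep \<mu>)"
      by (simp add: class_coeff_eq Const_sum sum_distrib_right)
  qed simp
  also have "\<dots> \<in> q"
  proof (rule ideal_sum[OF ideal_q])
    fix \<mu> assume "\<mu> \<in> mon_class ` Poly_Mapping.keys f"
    then obtain m where m: "m \<in> Poly_Mapping.keys f" "\<mu> = mon_class m" by blast
    show "Const (class_coeff f \<mu>) * monomial (rep \<mu>) \<in> q"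
    proof (cases "snd \<mu> < r j")
      case True
      then show ?thesis
        using kernelD[OF f] ideal_mpoly_ringD(2)[OF ideal_q] by simp
    next
      case False
      then have "monomial (rep \<mu>) \<in> q"
        using monomial_in_q[of "rep \<mu>"] rep[OF keys[OF m(1)]] m(2) by simp
      then show ?thesis
        by (rule ideal_mpoly_ringD(7)[OF ideal_q])
    qed
  qed
  finally have "g \<in> q" .
  moreover have "f - g \<in> q"
  proof -
    have "f - g = (\<Sum>m\<in>Poly_Mapping.keys f.
        Const (Poly_Mapping.lookup f m) * (monomial m - monomial (rep (mon_class m))))"
      unfolding g_def right_diff_distrib sum_subtractf single_eq_Const_mult[symmetric]
        poly_mapping_eq_sum_single[symmetric] ..
    also have "\<dots> \<in> q"
      using monomial_diff_in_q keys rep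
      by (intro ideal_sum[OF ideal_q] ideal_mpoly_ringD(7)[OF ideal_q]) simp
    finally show ?thesis .
  qed
  ultimately show "f \<in> q"
    using ideal_mpoly_ringD(3)[OF ideal_q, of "f - g" g] by simp
qed

end

section \<open>The Hilbert function\<close>

lemma coset_eq_iff:
  fixes I :: "('v, 'a::comm_ring_1) mpol set"
  assumes I: "ideal I (mpoly_ring V)"
  shows "I +>\<^bsub>mpoly_ring V\<^esub> f = I +>\<^bsub>mpoly_ring V\<^esub> g \<longleftrightarrow> f - g \<in> I"
proof -
  have coset: "I +>\<^bsub>mpoly_ring V\<^esub> f = (\<lambda>h. h + f) ` I" for f
    by (auto simp: a_r_coset_def')
  show ?thesis
  proof
    assume "I +>\<^bsub>mpoly_ring V\<^esub> f = I +>\<^bsub>mpoly_ring V\<^esub> g"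
    moreover have "0 + f \<in> (\<lambda>h. h + f) ` I"
      using ideal_mpoly_ringD(2)[OF I] by blast
    ultimately obtain h where "h \<in> I" "f = h + g"
      unfolding coset by auto
    then show "f - g \<in> I" by simp
  next
    assume *: "f - g \<in> I"
    have "h + f = (h + (f - g)) + g" "h + g = (h - (f - g)) + f" for h by simp_all
    then show "I +>\<^bsub>mpoly_ring V\<^esub> f = I +>\<^bsub>mpoly_ring V\<^esub> g"
      unfolding coset using ideal_mpoly_ringD(3)[OF I _ *] ideal_mpoly_ringD(5)[OF I _ *] by blast
  qed
qed

text \<open>The dimension in \<open>hilbert_function\<close> is taken over the image of the
  constants in the quotient ring, which is a subfield by transport along the quotient map.\<close>

lemma subfield_Const: "subfield (range Const) (mpoly_ring V :: ('v, 'a::field) mpol ring)"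
proof -
  interpret cring "mpoly_ring V :: ('v, 'a) mpol ring" by (rule cring_mpoly_ring)
  let ?R = "mpoly_ring V :: ('v, 'a) mpol ring"
  have neg: "\<ominus>\<^bsub>?R\<^esub> Const c = Const (- c)" for c
    by (rule minus_equality) (simp_all add: Const_uminus)
  have "subring (range Const) ?R"
  proof (rule subringI)
    show "range Const \<subseteq> carrier ?R" by auto
    show "\<one>\<^bsub>?R\<^esub> \<in> range Const" using Const_1 by (metis mpoly_ring_simps(2) rangeI)
    show "\<ominus>\<^bsub>?R\<^esub> h \<in> range Const" if "h \<in> range Const" for h
      using that neg by auto
    show "h1 \<otimes>\<^bsub>?R\<^esub> h2 \<in> range Const" if "h1 \<in> range Const" "h2 \<in> range Const" for h1 h2
      using that by (auto simp flip: Const_mult)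
    show "h1 \<oplus>\<^bsub>?R\<^esub> h2 \<in> range Const" if "h1 \<in> range Const" "h2 \<in> range Const" for h1 h2
      using that by (auto simp flip: Const_add)
  qed
  then have "subcring (range Const) ?R" by (rule subcringI')
  moreover have Const_eq_0: "Const c = (0 :: ('v, 'a) mpol) \<longleftrightarrow> c = 0" for c
    by (metis Const_0 Const_def lookup_single_eq lookup_zero)
  have "Units (?R\<lparr>carrier := range Const\<rparr>) = range Const - {\<zero>\<^bsub>?R\<^esub>}"
  proof (intro equalityI subsetI)
    fix x assume "x \<in> Units (?R\<lparr>carrier := range Const\<rparr>)"
    then obtain y where "x \<in> range Const" "y * x = 1"
      by (auto simp: Units_def)
    then show "x \<in> range Const - {\<zero>\<^bsub>?R\<^esub>}" by auto
  next
    fix x assume "x \<in> range Const - {\<zero>\<^bsub>?R\<^esub>}"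
    then obtain c where "x = Const c" "c \<noteq> 0" by (auto simp: Const_eq_0)
    moreover from this have "Const (inverse c) * x = 1" "x * Const (inverse c) = 1"
      by (simp_all flip: Const_mult)
    ultimately show "x \<in> Units (?R\<lparr>carrier := range Const\<rparr>)"
      unfolding Units_def by auto
  qed
  ultimately show ?thesis by (intro subfieldI)
qed

text \<open>Coordinates that cut out \<open>I\<close> in degree \<open>t\<close>, together with a
  dual family \<open>e\<close> of forms, make the classes of the \<open>e \<mu>\<close> a basis. The
  dimension predicate grows by one line at a time, so the basis elements are adjoined one by
  one.\<close>

lemma hilbert_function_eq_card:
  fixes I :: "('v, 'a::field) mpol set" and coord :: "('v, 'a) mpol \<Rightarrow> 'c \<Rightarrow> 'a"
  assumes I: "ideal I (mpoly_ring V)" and "1 \<notin> I" and "finite S"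
    and add: "\<And>f g \<mu>. coord (f + g) \<mu> = coord f \<mu> + coord g \<mu>"
    and scale: "\<And>c f \<mu>. coord (Const c * f) \<mu> = c * coord f \<mu>"
    and mem_iff: "\<And>f. f \<in> graded_part V t \<Longrightarrow> f \<in> I \<longleftrightarrow> (\<forall>\<mu>\<in>S. coord f \<mu> = 0)"
    and basis: "\<And>\<mu>. \<mu> \<in> S \<Longrightarrow> e \<mu> \<in> graded_part V t"
    and dual: "\<And>\<mu> \<nu>. \<mu> \<in> S \<Longrightarrow> \<nu> \<in> S \<Longrightarrow> coord (e \<mu>) \<nu> = (if \<mu> = \<nu> then 1 else 0)"
  shows "hilbert_function V I t = card S"
proof -
  let ?R = "mpoly_ring V :: ('v, 'a) mpol ring"
  let ?A = "?R Quot I"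
  define h where "h = (\<lambda>f. I +>\<^bsub>?R\<^esub> f)"
  have hom: "ring_hom_ring ?R ?A h"
    unfolding h_def by (rule ideal.rcos_ring_hom_ring[OF I])
  note h = ring_hom_ring.homh[OF hom]
  interpret A: ring ?A by (rule ideal.quotient_is_ring[OF I])
  have h_eq: "h f = h g \<longleftrightarrow> f - g \<in> I" for f g
    unfolding h_def by (rule coset_eq_iff[OF I])
  have h_0: "h 0 = \<zero>\<^bsub>?A\<^esub>"
    using ring_hom_zero[OF h ring_mpoly_ring A.ring_axioms] by simp
  have h_add: "h f \<oplus>\<^bsub>?A\<^esub> h g = h (f + g)"
    and h_mult: "h f \<otimes>\<^bsub>?A\<^esub> h g = h (f * g)"
    and h_closed: "h f \<in> carrier ?A"
    if "f \<in> carrier ?R" "g \<in> carrier ?R" for f g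
    using ring_hom_add[OF h that] ring_hom_mult[OF h that] ring_hom_closed[OF h that(1)] by simp_all
  let ?K = "h ` range Const"
  have "\<one>\<^bsub>?A\<^esub> \<noteq> \<zero>\<^bsub>?A\<^esub>"
    using ring_hom_one[OF h] h_0 h_eq[of 1 0] \<open>1 \<notin> I\<close> by auto
  then have K: "subfield ?K ?A"
    by (rule ring_hom_ring.img_is_subfield(2)[OF hom subfield_Const])
  \<comment> \<open>Forms whose coordinates outside \<open>T\<close> vanish: modulo \<open>I\<close>
    this is the span of the \<open>e \<mu>\<close> with \<open>\<mu> \<in> T\<close>, which is zero
    for \<open>T = {}\<close> and everything for \<open>T = S\<close>.\<close>
  define G where "G T = {f \<in> graded_part V t. \<forall>\<mu>\<in>S - T. coord f \<mu> = 0}" for T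
  have G_carrier: "f \<in> G T \<Longrightarrow> f \<in> carrier ?R" for f T
    by (auto simp: G_def graded_partD)
  have minus: "coord (f - Const c * g) \<mu> = coord f \<mu> - c * coord g \<mu>" for f g c \<mu>
    using add[of f "Const (- c) * g" \<mu>] scale[of "- c" g \<mu>] by (simp add: Const_uminus)
  have "A.dimension (card T) ?K (h ` G T)" if "T \<subseteq> S" for T
    using finite_subset[OF that \<open>finite S\<close>] that
  proof (induction T rule: finite_induct)
    case empty
    have "0 \<in> G {}"
      using mem_iff[of 0] ideal_mpoly_ringD(2)[OF I] by (simp add: G_def)
    moreover have "h f = \<zero>\<^bsub>?A\<^esub>" if "f \<in> G {}" for f
      using that mem_iff[of f] h_eq[of f 0] h_0 by (simp add: G_def)
    ultimately have "h ` G {} = {\<zero>\<^bsub>?A\<^esub>}"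
      by (auto simp: image_iff intro: h_0[symmetric])
    then show ?case by (simp add: A.zero_dim)
  next
    case (insert \<mu> T)
    then have \<mu>: "\<mu> \<in> S" by simp
    note e = basis[OF \<mu>] graded_partD(1)[OF basis[OF \<mu>]]
    have "h (e \<mu>) \<notin> h ` G T"
    proof
      assume "h (e \<mu>) \<in> h ` G T"
      then obtain g where g: "g \<in> G T" "h (e \<mu>) = h g" by blast
      then have "e \<mu> - g \<in> I" "e \<mu> - g \<in> graded_part V t"
        using h_eq e(1) graded_part_diff by (auto simp: G_def)
      \<comment> \<open>The factor \<open>Const 1\<close> gives the difference the shape of
        \<open>minus\<close>; at \<open>\<mu>\<close> the coordinate of \<open>e \<mu>\<close> is 1
        and that of \<open>g\<close> is 0.\<close>
      then have "coord (e \<mu> - Const 1 * g) \<mu> = 0"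
        using mem_iff \<mu> by simp
      then show False
        using g(1) insert.hyps \<mu> dual[OF \<mu> \<mu>] unfolding minus by (simp add: G_def)
    qed
    moreover have "h (e \<mu>) \<in> carrier ?A"
      using h_closed e(2) by blast
    moreover have "A.dimension (card T) ?K (h ` G T)"
      using insert by simp
    ultimately have "A.dimension (Suc (card T)) ?K (A.line_extension ?K (h (e \<mu>)) (h ` G T))"
      by (intro A.Suc_dim)
    moreover have "A.line_extension ?K (h (e \<mu>)) (h ` G T) = h ` G (insert \<mu> T)"
    proof (intro equalityI subsetI)
      fix u assume "u \<in> A.line_extension ?K (h (e \<mu>)) (h ` G T)"
      then obtain c g where g: "g \<in> G T" "u = h (Const c) \<otimes>\<^bsub>?A\<^esub> h (e \<mu>) \<oplus>\<^bsub>?A\<^esub> h g"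
        unfolding A.line_extension_mem_iff by blast
      then have "u = h (Const c * e \<mu> + g)"
        using G_carrier[OF g(1)] e(2) by (simp add: h_mult h_add)
      moreover have "Const c * e \<mu> + g \<in> G (insert \<mu> T)"
        using g(1) e(1) \<mu> dual
        by (auto simp: G_def add scale intro: graded_part_add graded_part_Const_mult)
      ultimately show "u \<in> h ` G (insert \<mu> T)" by blast
    next
      fix u assume "u \<in> h ` G (insert \<mu> T)"
      then obtain f where f: "f \<in> G (insert \<mu> T)" "u = h f" by blast
      let ?c = "coord f \<mu>"
      let ?g = "f - Const ?c * e \<mu>"
      have g: "?g \<in> G T"
        using f(1) e(1) \<mu> dual
        by (auto simp: G_def minus intro: graded_part_diff graded_part_Const_mult)
      have "u = h (Const ?c) \<otimes>\<^bsub>?A\<^esub> h (e \<mu>) \<oplus>\<^bsub>?A\<^esub> h ?g"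
        using G_carrier[OF g] e(2) f(2) by (simp add: h_mult h_add)
      with g show "u \<in> A.line_extension ?K (h (e \<mu>)) (h ` G T)"
        unfolding A.line_extension_mem_iff by blast
    qed
    ultimately show ?case
      using insert.hyps by simp
  qed
  from A.dimI[OF K this[OF subset_refl]] have "(A.dim over ?K) (h ` G S) = card S" .
  moreover have "G S = graded_part V t"
    by (simp add: G_def)
  moreover have "?K = (\<lambda>c. I +>\<^bsub>?R\<^esub> Const c) ` UNIV"
    by (simp add: h_def image_image)
  ultimately show ?thesis
    unfolding hilbert_function_def Let_def h_def by simp
qed

text \<open>Stars and bars: reading the exponents along an enumeration of \<open>B\<close> gives a
  bijection with the lists of \<open>card B\<close> natural numbers of sum \<open>t\<close>.\<close>

lemma card_mon_degree_eq:
  fixes B :: "'b set"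
  assumes "finite B"
  shows "card {D. Poly_Mapping.keys D \<subseteq> B \<and> mon_degree D = t} = (t + card B - 1) choose t"
proof -
  obtain xs where xs: "set xs = B" "distinct xs"
    using finite_distinct_list[OF assms] by blast
  have degree: "mon_degree D = sum_list (map (Poly_Mapping.lookup D) xs)"
    if "Poly_Mapping.keys D \<subseteq> B" for D :: "'b \<Rightarrow>\<^sub>0 nat"
  proof -
    have "mon_degree D = (\<Sum>v\<in>B. Poly_Mapping.lookup D v)"
      unfolding mon_degree_def using that assms
      by (intro sum.mono_neutral_left) (auto simp: in_keys_iff)
    also have "\<dots> = sum_list (map (Poly_Mapping.lookup D) xs)"
      using sum_list_distinct_conv_sum_set[OF xs(2)] xs(1) by metis
    finally show ?thesis .
  qed
  have "bij_betw (\<lambda>D. map (Poly_Mapping.lookup D) xs)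
      {D. Poly_Mapping.keys D \<subseteq> B \<and> mon_degree D = t} {ns. length ns = length xs \<and> sum_list ns = t}"
  proof (intro bij_betw_imageI inj_onI equalityI subsetI)
    fix D E :: "'b \<Rightarrow>\<^sub>0 nat"
    assume D: "D \<in> {D. Poly_Mapping.keys D \<subseteq> B \<and> mon_degree D = t}"
      and E: "E \<in> {D. Poly_Mapping.keys D \<subseteq> B \<and> mon_degree D = t}"
      and eq: "map (Poly_Mapping.lookup D) xs = map (Poly_Mapping.lookup E) xs"
    show "D = E"
    proof (rule poly_mapping_eqI)
      fix v
      show "Poly_Mapping.lookup D v = Poly_Mapping.lookup E v"
      proof (cases "v \<in> B")
        case True
        then show ?thesis using eq xs(1) by (simp add: map_eq_conv)
      next
        case False
        then have "v \<notin> Poly_Mapping.keys D" "v \<notin> Poly_Mapping.keys E" using D E by auto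
        then show ?thesis by (simp add: in_keys_iff)
      qed
    qed
  next
    fix ns assume "ns \<in> (\<lambda>D. map (Poly_Mapping.lookup D) xs) `
      {D. Poly_Mapping.keys D \<subseteq> B \<and> mon_degree D = t}"
    then show "ns \<in> {ns. length ns = length xs \<and> sum_list ns = t}"
      using degree by auto
  next
    fix ns assume ns: "ns \<in> {ns. length ns = length xs \<and> sum_list ns = t}"
    define D where "D = (\<Sum>i<length xs. Poly_Mapping.single (xs ! i) (ns ! i))"
    have lookup: "Poly_Mapping.lookup D v = (\<Sum>i<length xs. ns ! i when xs ! i = v)" for v
      by (simp add: D_def lookup_sum lookup_single)
    have "Poly_Mapping.lookup D (xs ! i) = ns ! i" if "i < length xs" for i
    proof -
      have "Poly_Mapping.lookup D (xs ! i) = (\<Sum>i'<length xs. if i' = i then ns ! i' else 0)"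
        unfolding lookup using that xs(2)
        by (intro sum.cong) (auto simp: when_def nth_eq_iff_index_eq)
      then show ?thesis using that by (simp add: sum.delta)
    qed
    then have map: "map (Poly_Mapping.lookup D) xs = ns"
      using ns by (intro nth_equalityI) auto
    have keys: "Poly_Mapping.keys D \<subseteq> B"
    proof
      fix v assume "v \<in> Poly_Mapping.keys D"
      then have "(\<Sum>i<length xs. ns ! i when xs ! i = v) \<noteq> 0"
        by (simp add: in_keys_iff lookup)
      then obtain i where "i < length xs" "(ns ! i when xs ! i = v) \<noteq> 0"
        by (metis (no_types, lifting) lessThan_iff sum.not_neutral_contains_not_neutral)
      then have "i < length xs" "xs ! i = v"
        by (auto simp: when_def split: if_splits)
      then show "v \<in> B" using xs(1) by auto
    qed
    moreover have "mon_degree D = t"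
      using degree[OF keys] map ns by simp
    ultimately show "ns \<in> (\<lambda>D. map (Poly_Mapping.lookup D) xs) `
      {D. Poly_Mapping.keys D \<subseteq> B \<and> mon_degree D = t}"
      using map by (intro image_eqI[of _ _ D]) auto
  qed
  then have "card {D. Poly_Mapping.keys D \<subseteq> B \<and> mon_degree D = t} =
      card {ns::nat list. length ns = length xs \<and> sum_list ns = t}"
    by (rule bij_betw_same_card)
  also have "\<dots> = (t + length xs - 1) choose t"
    by (rule card_length_sum_list)
  also have "length xs = card B"
    using xs distinct_card by fastforce
  finally show ?thesis .
qed

section \<open>A basis of the graded pieces of the quotient\<close>

context jordan_component
begin

abbreviation "K \<equiv> \<Sum>i=1..j. k i"

definition blocks :: "(nat \<times> nat) set" where
  "blocks = (SIGMA a:{1..j}. {1..k a})"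

text \<open>The monomial basis, in degree \<open>t\<close>, of the polynomial ring in
  \<open>s\<close> and the \<open>z(a,b)\<close> with \<open>a \<le> j\<close>, modulo
  \<open>s ^ r j\<close>; here \<open>s\<close> has degree 0.\<close>

definition basis_classes :: "nat \<Rightarrow> (((nat \<times> nat) \<Rightarrow>\<^sub>0 nat) \<times> nat) set" where
  "basis_classes t = {D. Poly_Mapping.keys D \<subseteq> blocks \<and> mon_degree D = t} \<times> {..<r j}"

lemma card_blocks: "card blocks = K"
  by (simp add: blocks_def)

lemma finite_blocks: "finite blocks"
  by (simp add: blocks_def)

lemma K_pos: "K > 0"
proof -
  have "k j \<le> K"
    using j_range by (intro member_le_sum) auto
  then show ?thesis
    using k_pos[OF j_range] by linarith
qed

text \<open>The symmetry of binomial coefficients moves to a lower index independent of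
  \<open>t\<close>, which makes the count a polynomial in \<open>t\<close>.\<close>

lemma card_basis_classes: "card (basis_classes t) = r j * ((t + (K - 1)) choose (K - 1))"
proof -
  have "t + K - 1 = t + (K - 1)"
    using K_pos by simp
  then have "(t + K - 1) choose t = (t + (K - 1)) choose (K - 1)"
    using binomial_symmetric[of t "t + (K - 1)"] by simp
  then show ?thesis
    by (simp add: basis_classes_def card_cartesian_product card_mon_degree_eq[OF finite_blocks] card_blocks)
qed

lemma finite_basis_classes: "finite (basis_classes t)"
proof -
  have "card (basis_classes t) > 0"
    using r_j_pos by (simp add: card_basis_classes)
  then show ?thesis by (rule card_ge_0_finite)
qed

text \<open>A factor outside \<open>good\<close> would contribute weight at least \<open>r j\<close>
  on its own, so a class of smaller weight only involves blocks \<open>(a, b)\<close> with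
  \<open>a \<le> j\<close>.\<close>

lemma class_coeff_support:
  assumes "f \<in> graded_part V t" and "class_coeff f \<mu> \<noteq> 0" and "snd \<mu> < r j"
  shows "\<mu> \<in> basis_classes t"
proof -
  obtain m where m: "m \<in> Poly_Mapping.keys f" "mon_class m = \<mu>"
    using class_coeff_nonzeroE[OF assms(2)] .
  have "block v \<in> blocks" if v: "v \<in> Poly_Mapping.keys m" for v
  proof -
    have "v \<in> V" using graded_partD(3)[OF assms(1) m(1)] v by blast
    moreover have "weight v < r j" using weight_le_mon_class[OF v] m(2) assms(3) by simp
    ultimately have "v \<in> good" using weight_not_good by fastforce
    then show ?thesis by (rule goodE) (auto simp: blocks_def)
  qed
  then have "Poly_Mapping.keys (fst \<mu>) \<subseteq> blocks"
    using keys_mon_class[of m] m(2) by auto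
  moreover have "mon_degree (fst \<mu>) = t"
    using mon_degree_mon_class[of m] graded_partD(2)[OF assms(1) m(1)] m(2) by simp
  ultimately show ?thesis
    using assms(3) by (cases \<mu>) (simp add: basis_classes_def)
qed

lemma mem_q_iff:
  assumes "f \<in> graded_part V t"
  shows "f \<in> q \<longleftrightarrow> (\<forall>\<mu>\<in>basis_classes t. class_coeff f \<mu> = 0)"
proof
  assume "f \<in> q"
  then have "f \<in> kernel" by (simp add: q_eq_kernel)
  then show "\<forall>\<mu>\<in>basis_classes t. class_coeff f \<mu> = 0"
    by (intro ballI kernelD) (auto simp: basis_classes_def)
next
  assume "\<forall>\<mu>\<in>basis_classes t. class_coeff f \<mu> = 0"
  then have "\<forall>\<mu>. snd \<mu> < r j \<longrightarrow> class_coeff f \<mu> = 0"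
    using class_coeff_support[OF assms] by blast
  then show "f \<in> q"
    using graded_partD(1)[OF assms] unfolding q_eq_kernel kernel_def by blast
qed

lemma one_notin_q: "1 \<notin> q"
proof
  assume "1 \<in> q"
  then have "class_coeff 1 0 = 0"
    unfolding q_eq_kernel by (rule kernelD) (simp add: r_j_pos)
  then show False
    using class_coeff_single[of 0 1 0] by simp
qed

lemma mon_class_base_monomial:
  assumes "Poly_Mapping.keys D \<subseteq> blocks"
  shows "mon_class (base_monomial D) = (D, 0)"
proof -
  have sum: "mon_class (sum f A) = (\<Sum>x\<in>A. mon_class (f x))" for f :: "nat \<times> nat \<Rightarrow> _" and A
    by (induction A rule: infinite_finite_induct) (simp_all add: mon_class_add)
  have "mon_class (base_monomial D) =
      (\<Sum>i\<in>Poly_Mapping.keys D. mon_class (Poly_Mapping.single (fst i, snd i, 1) (Poly_Mapping.lookup D i)))"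
    by (simp only: base_monomial_def sum)
  also have "\<dots> = (\<Sum>i\<in>Poly_Mapping.keys D. (Poly_Mapping.single i (Poly_Mapping.lookup D i), 0))"
    using assms by (intro sum.cong) (auto simp: mon_class_single block_def weight_def blocks_def)
  also have "\<dots> = (\<Sum>i\<in>Poly_Mapping.keys D. Poly_Mapping.single i (Poly_Mapping.lookup D i), 0)"
    by (rule prod_eqI) (simp_all add: fst_sum snd_sum)
  also have "\<dots> = (D, 0)"
    by (simp only: poly_mapping_eq_sum_single[symmetric])
  finally show ?thesis .
qed

lemma keys_base_monomial:
  assumes "Poly_Mapping.keys D \<subseteq> blocks"
  shows "Poly_Mapping.keys (base_monomial D) \<subseteq> V"
proof
  fix v assume "v \<in> Poly_Mapping.keys (base_monomial D)"
  then have "(\<Sum>i\<in>Poly_Mapping.keys D.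
      Poly_Mapping.lookup D i when (fst i, snd i, 1) = v) \<noteq> 0"
    by (simp add: base_monomial_def in_keys_iff lookup_sum lookup_single)
  then obtain i where "i \<in> Poly_Mapping.keys D" "(Poly_Mapping.lookup D i when (fst i, snd i, 1) = v) \<noteq> 0"
    by (metis (no_types, lifting) sum.not_neutral_contains_not_neutral)
  then have "v = (fst i, snd i, 1)" "i \<in> blocks"
    using assms by (auto simp: when_def split: if_splits)
  then show "v \<in> V"
    using j_range r_pos[of "fst i"] by (auto simp: blocks_def Lam_iff)
qed

text \<open>One factor carries the whole weight \<open>e\<close> as \<open>x(a,b,e+1)\<close>, and
  the other factors are first variables of their blocks; \<open>t > 0\<close> provides the factor
  that carries it.\<close>

lemma basis_monomial:
  assumes "\<mu> \<in> basis_classes t" and "t > 0"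
  obtains m where "Poly_Mapping.keys m \<subseteq> V" "mon_class m = \<mu>" "mon_degree m = t"
proof -
  obtain D e where \<mu>: "\<mu> = (D, e)" and D: "Poly_Mapping.keys D \<subseteq> blocks" "mon_degree D = t" and e: "e < r j"
    using assms(1) by (auto simp: basis_classes_def)
  have "Poly_Mapping.keys D \<noteq> {}"
    using D(2) assms(2) by (auto simp: mon_degree_def)
  then obtain i where i: "i \<in> Poly_Mapping.keys D" by blast
  obtain a b where ab: "i = (a, b)" by (cases i)
  obtain D' where D': "D = Poly_Mapping.single i 1 + D'"
    using poly_mapping_split_single[OF i] .
  then have D'_blocks: "Poly_Mapping.keys D' \<subseteq> blocks"
    using D(1) by (simp add: keys_add_nat)
  define m where "m = Poly_Mapping.single (a, b, Suc e) 1 + base_monomial D'"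
  have "i \<in> blocks" using i D(1) by blast
  then have "(a, b, Suc e) \<in> good"
    using ab e by (simp add: good_def blocks_def)
  then have v: "(a, b, Suc e) \<in> V" "weight (a, b, Suc e) = e" "block (a, b, Suc e) = i"
    using good_subset by (auto simp: ab good_def weight_def block_def)
  have m_class: "mon_class m = \<mu>"
    by (simp add: m_def mon_class_add mon_class_single v mon_class_base_monomial[OF D'_blocks] \<mu> D')
  have "mon_degree m = t"
    using mon_degree_mon_class[of m] D(2) by (simp add: m_class \<mu>)
  moreover have "Poly_Mapping.keys m \<subseteq> V"
    using keys_base_monomial[OF D'_blocks] v(1) by (simp add: m_def keys_add_nat)
  ultimately show thesis
    using that m_class by blast
qed

theorem hilbert_function_q:
  assumes "t > 0"
  shows "hilbert_function V q t = r j * ((t + (K - 1)) choose (K - 1))"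
proof -
  define e where "e \<mu> = (SOME m. Poly_Mapping.keys m \<subseteq> V \<and> mon_class m = \<mu> \<and> mon_degree m = t)" for \<mu>
  have e: "Poly_Mapping.keys (e \<mu>) \<subseteq> V \<and> mon_class (e \<mu>) = \<mu> \<and> mon_degree (e \<mu>) = t"
    if \<mu>: "\<mu> \<in> basis_classes t" for \<mu>
  proof -
    obtain m where "Poly_Mapping.keys m \<subseteq> V \<and> mon_class m = \<mu> \<and> mon_degree m = t"
      using basis_monomial[OF \<mu> assms] by blast
    then show ?thesis
      unfolding e_def by (rule someI)
  qed
  have "hilbert_function V q t = card (basis_classes t)"
  proof (rule hilbert_function_eq_card[where coord = class_coeff and e = "\<lambda>\<mu>. monomial (e \<mu>)"])
    show "monomial (e \<mu>) \<in> graded_part V t" if "\<mu> \<in> basis_classes t" for \<mu>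
      using single_in_graded_part[of "e \<mu>" V 1] e[OF that] by simp
    show "class_coeff (monomial (e \<mu>)) \<nu> = (if \<mu> = \<nu> then 1 else 0)"
      if "\<mu> \<in> basis_classes t" "\<nu> \<in> basis_classes t" for \<mu> \<nu>
      using e[OF that(1)] by (simp add: class_coeff_single when_def)
  qed (use ideal_q one_notin_q finite_basis_classes class_coeff_add class_coeff_Const_mult mem_q_iff in auto)
  then show ?thesis
    by (simp add: card_basis_classes)
qed

lemma has_hilbert_poly_q: "has_hilbert_poly V q (smult (of_nat (r j)) (binom_poly (K - 1)))"
  unfolding has_hilbert_poly_def
proof (intro exI allI impI)
  fix t :: nat assume "t \<ge> 1"
  then show "poly (smult (of_nat (r j)) (binom_poly (K - 1))) (of_nat t) = of_nat (hilbert_function V q t)"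
    by (simp add: poly_binom_poly_of_nat hilbert_function_q)
qed

text \<open>The product in \<open>binom_poly\<close> is monic of degree \<open>K - 1\<close>, so the
  factorial in the definition of the degree cancels its denominator; \<open>r j > 0\<close> keeps
  the scalar from lowering the polynomial degree.\<close>

lemma subscheme_degree_q: "subscheme_degree V q = of_nat (r j)"
proof -
  let ?n = "K - 1"
  let ?p = "\<Prod>i=0..<?n. [:of_nat ?n - of_nat i, 1:] :: rat poly"
  have "degree ?p = ?n"
    by (subst degree_prod_eq_sum_degree) auto
  moreover have "lead_coeff ?p = 1"
    by (simp add: lead_coeff_prod)
  moreover have "of_nat (r j) \<noteq> (0::rat)"
    using r_j_pos by simp
  ultimately show ?thesis
    unfolding subscheme_degree_def hilbert_poly_eq[OF has_hilbert_poly_q] binom_poly_def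
    by simp
qed

end

section \<open>Chains of homogeneous primes\<close>

text \<open>Gaussian elimination: a homogeneous system with fewer equations than unknowns has a
  nontrivial solution.\<close>

lemma exists_linear_relation:
  fixes \<phi> :: "'x \<Rightarrow> 's \<Rightarrow> 'a::field"
  assumes "finite S" and "finite A" and "card S < card A"
  shows "\<exists>c. (\<exists>x\<in>A. c x \<noteq> 0) \<and> (\<forall>s\<in>S. (\<Sum>x\<in>A. c x * \<phi> x s) = 0)"
  using assms
proof (induction S arbitrary: A \<phi> rule: finite_induct)
  case empty
  then have "A \<noteq> {}" by auto
  then show ?case by (intro exI[of _ "\<lambda>_. 1"]) auto
next
  case (insert s S)
  show ?case
  proof (cases "\<forall>x\<in>A. \<phi> x s = 0")
    case True
    obtain c where "\<exists>x\<in>A. c x \<noteq> 0" "\<forall>s\<in>S. (\<Sum>x\<in>A. c x * \<phi> x s) = 0"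
      using insert.IH[of A \<phi>] insert.prems insert.hyps by auto
    with True show ?thesis
      by (intro exI[of _ c]) simp
  next
    case False
    then obtain y where y: "y \<in> A" "\<phi> y s \<noteq> 0" by blast
    \<comment> \<open>Solving equation \<open>s\<close> for the unknown at the pivot
      \<open>y\<close> and substituting leaves a system with one equation and one unknown
      less.\<close>
    define \<psi> where "\<psi> x s' = \<phi> x s' - \<phi> x s / \<phi> y s * \<phi> y s'" for x s'
    have "card S < card (A - {y})"
      using insert y by simp
    then obtain c where c: "\<exists>x\<in>A - {y}. c x \<noteq> 0" "\<forall>s\<in>S. (\<Sum>x\<in>A - {y}. c x * \<psi> x s) = 0"
      using insert.IH[of "A - {y}" \<psi>] insert.prems by auto
    \<comment> \<open>The value at \<open>y\<close> is the one dictated by equation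
      \<open>s\<close>.\<close>
    define d where "d x = (if x = y then - (\<Sum>x\<in>A - {y}. c x * (\<phi> x s / \<phi> y s)) else c x)" for x
    have sum: "(\<Sum>x\<in>A. d x * \<phi> x s') = (\<Sum>x\<in>A - {y}. c x * \<psi> x s')" for s'
    proof -
      have "(\<Sum>x\<in>A. d x * \<phi> x s') = d y * \<phi> y s' + (\<Sum>x\<in>A - {y}. c x * \<phi> x s')"
        unfolding sum.remove[OF insert.prems(1) y(1), of "\<lambda>x. d x * \<phi> x s'"]
        by (intro arg_cong2[of _ _ _ _ "(+)"] sum.cong) (auto simp: d_def)
      also have "d y * \<phi> y s' = - (\<Sum>x\<in>A - {y}. c x * (\<phi> x s / \<phi> y s) * \<phi> y s')"
        by (simp add: d_def sum_distrib_right)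
      finally show ?thesis
        by (simp add: \<psi>_def right_diff_distrib sum_subtractf mult.assoc)
    qed
    have "\<psi> x s = 0" for x
      using y(2) by (simp add: \<psi>_def)
    then have "\<forall>s'\<in>insert s S. (\<Sum>x\<in>A. d x * \<phi> x s') = 0"
      unfolding sum using c(2) by simp
    moreover have "\<exists>x\<in>A. d x \<noteq> 0"
      using c(1) by (auto simp: d_def)
    ultimately show ?thesis by blast
  qed
qed

text \<open>A crude bound of degree \<open>k\<close> in \<open>n\<close>; the induction rests on
  \<open>n + Suc k \<le> Suc k * (n + 1)\<close>.\<close>

lemma binomial_le_power: "(n + k) choose k \<le> (n + 1) ^ k"
proof (induction k)
  case (Suc k)
  have "Suc k * ((n + Suc k) choose Suc k) = (n + Suc k) * ((n + k) choose k)"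
    using Suc_times_binomial_eq[of "n + k" k] by (simp add: mult.commute)
  also have "\<dots> \<le> (Suc k * (n + 1)) * (n + 1) ^ k"
    using Suc by (intro mult_mono) auto
  finally have "Suc k * ((n + Suc k) choose Suc k) \<le> Suc k * (n + 1) ^ Suc k"
    by (simp only: power_Suc mult.assoc)
  then show ?case
    by (simp only: Suc_mult_le_cancel1)
qed simp

text \<open>The degree of the product of the powers of the \<open>g i\<close>, where
  \<open>g i\<close> has degree \<open>d i\<close> and the exponents are listed from the last index
  down to 0.\<close>

fun chain_weight :: "(nat \<Rightarrow> nat) \<Rightarrow> nat list \<Rightarrow> nat" where
  "chain_weight d [] = 0"
| "chain_weight d (s # \<alpha>) = s * d (length \<alpha>) + chain_weight d \<alpha>"

text \<open>
  The head of an exponent list belongs to the last element of the chain. With \<open>z\<close> of degree \<open>e\<close>, the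
  power of \<open>z\<close> fills up the degree of the product to \<open>e t\<close>.
\<close>

fun chain_product ::
    "(nat \<Rightarrow> 'b::comm_ring_1) \<Rightarrow> (nat \<Rightarrow> nat) \<Rightarrow> 'b \<Rightarrow> nat \<Rightarrow> nat list \<Rightarrow> nat \<Rightarrow> 'b" where
  "chain_product g d z e [] t = z ^ t"
| "chain_product g d z e (s # \<alpha>) t =
    g (length \<alpha>) ^ (e * s) * chain_product g d z e \<alpha> (t - s * d (length \<alpha>))"

definition exponent_lists :: "nat \<Rightarrow> nat \<Rightarrow> nat list set" where
  "exponent_lists n T = {\<alpha>. set \<alpha> \<subseteq> {..T} \<and> length \<alpha> = n}"

lemma finite_exponent_lists: "finite (exponent_lists n T)"
  unfolding exponent_lists_def by (rule finite_lists_length_eq) simp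

lemma card_exponent_lists: "card (exponent_lists n T) = (T + 1) ^ n"
  unfolding exponent_lists_def by (subst card_lists_length_eq) simp_all

lemma exponent_lists_0: "exponent_lists 0 T = {[]}"
  by (auto simp: exponent_lists_def)

lemma exponent_lists_Suc:
  "exponent_lists (Suc n) T = (\<lambda>(s, \<alpha>). s # \<alpha>) ` ({..T} \<times> exponent_lists n T)"
  by (force simp: exponent_lists_def image_iff length_Suc_conv)

lemma chain_weight_le:
  "\<alpha> \<in> exponent_lists n T \<Longrightarrow> chain_weight d \<alpha> \<le> T * (\<Sum>i<n. d i)"
proof (induction n arbitrary: \<alpha>)
  case 0
  then show ?case by (simp add: exponent_lists_0)
next
  case (Suc n)
  then obtain s \<beta> where \<alpha>: "\<alpha> = s # \<beta>" "s \<le> T" "\<beta> \<in> exponent_lists n T"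
    unfolding exponent_lists_Suc by auto
  then have "length \<beta> = n" by (simp add: exponent_lists_def)
  then have "chain_weight d \<alpha> \<le> T * d n + T * (\<Sum>i<n. d i)"
    using \<alpha> Suc.IH[OF \<alpha>(3)] by (simp add: add_mono)
  then show ?case by (simp add: distrib_left add.commute)
qed

text \<open>Models the vanishing ideals of an increasing chain of irreducible closed sets. Primality
  is asked only for products of forms, since the topology is generated by the non-vanishing loci of
  forms. The form \<open>g i\<close> tells consecutive ideals apart, and \<open>z\<close> lies
  outside the largest ideal, hence outside all of them.\<close>

locale prime_chain =
  fixes V :: "'v set" and n :: nat and I :: "nat \<Rightarrow> ('v, 'a::field) mpol set"
    and g :: "nat \<Rightarrow> ('v, 'a) mpol" and d :: "nat \<Rightarrow> nat" and z :: "('v, 'a) mpol" and e :: nat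
  assumes ideal: "i \<le> n \<Longrightarrow> ideal (I i) (mpoly_ring V)"
    and prime: "\<lbrakk>i \<le> n; f \<in> homogeneous_elems V; h \<in> homogeneous_elems V; f * h \<in> I i\<rbrakk> \<Longrightarrow>
      f \<in> I i \<or> h \<in> I i"
    and decreasing: "i < n \<Longrightarrow> I (Suc i) \<subseteq> I i"
    and g_in: "i < n \<Longrightarrow> g i \<in> I i"
    and g_notin: "i < n \<Longrightarrow> g i \<notin> I (Suc i)"
    and g_degree: "i < n \<Longrightarrow> g i \<in> graded_part V (d i)"
    and z_notin: "z \<notin> I 0"
    and z_degree: "z \<in> graded_part V e"
    and e_pos: "e > 0"
begin

abbreviation "product \<equiv> chain_product g d z e"

lemma product_degree:
  "length \<alpha> \<le> n \<Longrightarrow> chain_weight d \<alpha> \<le> t \<Longrightarrow> product \<alpha> t \<in> graded_part V (e * t)"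
proof (induction \<alpha> arbitrary: t)
  case Nil
  then show ?case
    using graded_part_power[OF z_degree, of t] by (simp add: mult.commute)
next
  case (Cons s \<alpha>)
  have "g (length \<alpha>) ^ (e * s) * product \<alpha> (t - s * d (length \<alpha>)) \<in>
      graded_part V (e * s * d (length \<alpha>) + e * (t - s * d (length \<alpha>)))"
    using Cons by (intro graded_part_mult graded_part_power g_degree Cons.IH) auto
  moreover have "e * s * d (length \<alpha>) + e * (t - s * d (length \<alpha>)) = e * t"
  proof -
    have "s * d (length \<alpha>) + (t - s * d (length \<alpha>)) = t"
      using Cons.prems by simp
    then show ?thesis
      by (metis distrib_left mult.assoc)
  qed
  ultimately show ?case by simp
qed

lemma power_notin:
  assumes "i \<le> n" and "f \<in> graded_part V t" and "f \<notin> I i"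
  shows "f ^ s \<notin> I i"
proof (induction s)
  case 0
  have "f * 1 \<in> I i" if "1 \<in> I i"
    using ideal_mpoly_ringD(6)[OF ideal[OF assms(1)] that] graded_partD(1)[OF assms(2)] by blast
  then show ?case using assms(3) by auto
next
  case (Suc s)
  have "f \<in> homogeneous_elems V" "f ^ s \<in> homogeneous_elems V"
    using assms(2) graded_part_power[OF assms(2)] by (auto simp: homogeneous_elems_def)
  then show ?case
    using prime[OF assms(1)] Suc assms(3) by auto
qed

text \<open>A relation is a polynomial in \<open>g m ^ e\<close> whose coefficients
  \<open>G s\<close> are combinations of the shorter products. A power of \<open>g m\<close>, which
  is not in \<open>I (Suc m)\<close>, can be cancelled from its lowest remaining term on; since
  \<open>g m \<in> I m\<close>, what is left modulo \<open>I m\<close> is a single coefficient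
  \<open>G s\<close>, a relation of length \<open>m\<close>.\<close>

lemma products_independent:
  assumes "m \<le> n" and "\<forall>\<alpha>\<in>exponent_lists m T. chain_weight d \<alpha> \<le> t"
    and "(\<Sum>\<alpha>\<in>exponent_lists m T. Const (c \<alpha>) * product \<alpha> t) \<in> I m"
    and "\<alpha> \<in> exponent_lists m T"
  shows "c \<alpha> = 0"
  using assms
proof (induction m arbitrary: c t \<alpha>)
  case 0
  show ?case
  proof (rule ccontr)
    assume "c \<alpha> \<noteq> 0"
    then have c: "c [] \<noteq> 0" using 0 by (simp add: exponent_lists_0)
    have "Const (c []) * z ^ t \<in> I 0"
      using 0 by (simp add: exponent_lists_0)
    then have "Const (inverse (c [])) * (Const (c []) * z ^ t) \<in> I 0"
      by (rule ideal_mpoly_ringD(7)[OF ideal[OF le0]])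
    moreover have "Const (inverse (c [])) * (Const (c []) * z ^ t) = z ^ t"
      using c by (simp flip: mult.assoc Const_mult)
    ultimately show False
      using power_notin[OF _ z_degree z_notin] by simp
  qed
next
  case (Suc m)
  then have m: "m < n" "m \<le> n" by simp_all
  let ?L = "exponent_lists m T"
  define G where "G s = (\<Sum>\<alpha>\<in>?L. Const (c (s # \<alpha>)) * product \<alpha> (t - s * d m))" for s
  have len: "length \<alpha> = m" if "\<alpha> \<in> ?L" for \<alpha>
    using that by (simp add: exponent_lists_def)
  have weight: "s * d m + chain_weight d \<alpha> \<le> t" if "s \<le> T" "\<alpha> \<in> ?L" for s \<alpha>
    using Suc.prems(2) that len[OF that(2)] unfolding exponent_lists_Suc by force
  have sd_le: "s * d m \<le> t" if s: "s \<le> T" for s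
  proof -
    \<comment> \<open>The zero list turns the bound on total weights into one on
      \<open>s * d m\<close> alone, so that no subtraction below is truncated.\<close>
    have "replicate m 0 \<in> ?L" by (auto simp: exponent_lists_def)
    then show ?thesis using weight[OF s] by force
  qed
  have G_degree: "G s \<in> graded_part V (e * (t - s * d m))" if "s \<le> T" for s
    unfolding G_def using weight[OF that] len m
    by (intro graded_part_sum graded_part_Const_mult product_degree) fastforce+
  have "(\<Sum>\<alpha>\<in>exponent_lists (Suc m) T. Const (c \<alpha>) * product \<alpha> t) =
      (\<Sum>(s, \<alpha>)\<in>{..T} \<times> ?L. Const (c (s # \<alpha>)) * product (s # \<alpha>) t)"
    unfolding exponent_lists_Suc
    by (subst sum.reindex) (auto simp: inj_on_def case_prod_unfold)
  also have "\<dots> = (\<Sum>s\<le>T. \<Sum>\<alpha>\<in>?L. Const (c (s # \<alpha>)) * product (s # \<alpha>) t)"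
    by (rule sum.cartesian_product[symmetric])
  also have "\<dots> = (\<Sum>s\<le>T. g m ^ (e * s) * G s)"
    by (intro sum.cong) (simp_all add: G_def sum_distrib_left len mult_ac)
  finally have sum_in: "(\<Sum>s\<le>T. g m ^ (e * s) * G s) \<in> I (Suc m)"
    using Suc.prems(3) by simp
  have zero: "\<forall>\<alpha>\<in>?L. c (s # \<alpha>) = 0" if "s \<le> T" for s
    using that
  proof (induction s rule: less_induct)
    case (less s)
    \<comment> \<open>What remains of the relation after the vanishing coefficients below
      \<open>s\<close> are dropped and \<open>g m ^ (e * s)\<close> is taken out.\<close>
    define H where "H = (\<Sum>s'\<in>{s..T}. g m ^ (e * (s' - s)) * G s')"
    have "G s' = 0" if "s' < s" for s'
      using less that by (simp add: G_def)
    then have "(\<Sum>s\<le>T. g m ^ (e * s) * G s) = (\<Sum>s'\<in>{s..T}. g m ^ (e * s') * G s')"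
      by (intro sum.mono_neutral_right) auto
    also have "\<dots> = g m ^ (e * s) * H"
      unfolding H_def sum_distrib_left
    proof (rule sum.cong)
      fix s' assume "s' \<in> {s..T}"
      then have "e * s' = e * s + e * (s' - s)"
        by (simp flip: distrib_left)
      then show "g m ^ (e * s') * G s' = g m ^ (e * s) * (g m ^ (e * (s' - s)) * G s')"
        by (simp only: power_add mult.assoc)
    qed simp
    finally have gH: "g m ^ (e * s) * H \<in> I (Suc m)"
      using sum_in by simp
    \<comment> \<open>All terms of \<open>H\<close> have the same degree; this matters because
      primality applies to forms only.\<close>
    have "H \<in> graded_part V (e * (t - s * d m))"
      unfolding H_def
    proof (rule graded_part_sum)
      fix s' assume s': "s' \<in> {s..T}"
      have "g m ^ (e * (s' - s)) * G s' \<in> graded_part V (e * (s' - s) * d m + e * (t - s' * d m))"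
        using s' by (intro graded_part_mult graded_part_power g_degree[OF m(1)] G_degree) simp
      moreover have "e * (s' - s) * d m + e * (t - s' * d m) = e * (t - s * d m)"
      proof -
        have "(s' - s) * d m + (t - s' * d m) = t - s * d m"
          using s' sd_le[of s'] by (simp add: diff_mult_distrib)
        then show ?thesis
          by (metis distrib_left mult.assoc)
      qed
      ultimately show "g m ^ (e * (s' - s)) * G s' \<in> graded_part V (e * (t - s * d m))" by simp
    qed
    then have "H \<in> homogeneous_elems V" "g m ^ (e * s) \<in> homogeneous_elems V"
      using graded_part_power[OF g_degree[OF m(1)]] by (auto simp: homogeneous_elems_def)
    then have "H \<in> I (Suc m)"
      using prime[OF Suc.prems(1) _ _ gH] power_notin[OF Suc.prems(1) g_degree[OF m(1)] g_notin[OF m(1)]]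
      by blast
    then have H_in: "H \<in> I m"
      using decreasing[OF m(1)] by blast
    have "(\<Sum>s'\<in>{Suc s..T}. g m ^ (e * (s' - s)) * G s') \<in> I m"
    proof (rule ideal_sum[OF ideal[OF m(2)]])
      fix s' assume s': "s' \<in> {Suc s..T}"
      \<comment> \<open>Here \<open>e > 0\<close> enters: a positive difference
        \<open>s' - s\<close> leaves at least one factor \<open>g m\<close>.\<close>
      then obtain p where p: "e * (s' - s) = Suc p"
        using e_pos by (metis Suc_le_lessD atLeastAtMost_iff gr0_implies_Suc mult_pos_pos zero_less_diff)
      have "g m ^ p * G s' \<in> carrier (mpoly_ring V)"
        using s' graded_partD(1)[OF graded_part_mult[OF graded_part_power[OF g_degree[OF m(1)]] G_degree]]
        by auto
      from ideal_mpoly_ringD(6)[OF ideal[OF m(2)] g_in[OF m(1)] this]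
      show "g m ^ (e * (s' - s)) * G s' \<in> I m"
        by (simp add: p mult_ac)
    qed
    moreover have "H = G s + (\<Sum>s'\<in>{Suc s..T}. g m ^ (e * (s' - s)) * G s')"
      unfolding H_def using less.prems by (subst sum.atLeast_Suc_atMost) simp_all
    ultimately have "G s \<in> I m"
      using ideal_mpoly_ringD(5)[OF ideal[OF m(2)] H_in] by fastforce
    moreover have "\<forall>\<alpha>\<in>?L. chain_weight d \<alpha> \<le> t - s * d m"
      using weight[OF less.prems] by fastforce
    ultimately show ?case
      using Suc.IH[OF m(2), of "t - s * d m" "\<lambda>\<alpha>. c (s # \<alpha>)"] by (auto simp: G_def)
  qed
  show ?case
    using zero Suc.prems(4) unfolding exponent_lists_Suc by auto
qed

end

section \<open>The bound on the length of a chain\<close>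

context jordan_component
begin

text \<open>Otherwise the products outnumber the dimension of the quotient in their common degree,
  and a linear relation modulo \<open>q \<subseteq> I n\<close> contradicts their
  independence.\<close>

lemma prime_chain_length:
  assumes "prime_chain V n I g d z e" and "q \<subseteq> I n"
  shows "n < K"
proof (rule ccontr)
  assume "\<not> n < K"
  interpret prime_chain V n I g d z e by (rule assms(1))
  define D where "D = (\<Sum>i<n. d i)"
  \<comment> \<open>\<open>T\<close> absorbs the constants:
    \<open>r j * ((e * D + 1) * (T + 1)) ^ (K - 1)\<close> becomes
    \<open>T * (T + 1) ^ (K - 1)\<close>, which is just below \<open>(T + 1) ^ K\<close>. The value
    \<open>t = T * D\<close> bounds the weight of every list of exponents up to
    \<open>T\<close>.\<close>
  define T where "T = r j * (e * D + 1) ^ (K - 1)"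
  define t where "t = T * D"
  let ?L = "exponent_lists n T" and ?S = "basis_classes (e * t)"
  have weight: "\<forall>\<alpha>\<in>?L. chain_weight d \<alpha> \<le> t"
    using chain_weight_le unfolding t_def D_def by blast
  have "card ?S \<le> r j * (e * t + 1) ^ (K - 1)"
    unfolding card_basis_classes by (intro mult_left_mono binomial_le_power) simp
  also have "\<dots> \<le> r j * ((e * D + 1) * (T + 1)) ^ (K - 1)"
    by (intro mult_left_mono power_mono) (simp_all add: t_def algebra_simps)
  also have "\<dots> = T * (T + 1) ^ (K - 1)"
    by (simp only: power_mult_distrib mult.assoc[symmetric] T_def[symmetric])
  also have "\<dots> < (T + 1) * (T + 1) ^ (K - 1)"
    by simp
  also have "\<dots> = (T + 1) ^ K"
    using K_pos by (metis power_eq_if neq0_conv)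
  also have "\<dots> \<le> (T + 1) ^ n"
    using \<open>\<not> n < K\<close> by (intro power_increasing) auto
  finally have "card ?S < card ?L"
    by (simp only: card_exponent_lists)
  then obtain c where c: "\<exists>\<alpha>\<in>?L. c \<alpha> \<noteq> 0"
      "\<forall>\<mu>\<in>?S. (\<Sum>\<alpha>\<in>?L. c \<alpha> * class_coeff (product \<alpha> t) \<mu>) = 0"
    using exists_linear_relation[OF finite_basis_classes finite_exponent_lists,
        of "e * t" n T "\<lambda>\<alpha>. class_coeff (product \<alpha> t)"] by blast
  let ?f = "\<Sum>\<alpha>\<in>?L. Const (c \<alpha>) * product \<alpha> t"
  have "?f \<in> graded_part V (e * t)"
    using weight
    by (intro graded_part_sum graded_part_Const_mult product_degree) (auto simp: exponent_lists_def)
  then have "?f \<in> q"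
    using c(2) by (simp add: mem_q_iff class_coeff_sum class_coeff_Const_mult)
  then have "?f \<in> I n"
    using assms(2) by blast
  from products_independent[OF order_refl weight this] c(1) show False
    by blast
qed

end

section \<open>The dimension of the subscheme\<close>

lemma one_notin_primeideal:
  assumes "primeideal p (mpoly_ring V :: ('v, 'a::comm_ring_1) mpol ring)"
  shows "1 \<notin> p"
proof
  assume "1 \<in> p"
  interpret primeideal p "mpoly_ring V" by (rule assms)
  have "carrier (mpoly_ring V) \<subseteq> p"
    using I_l_closed[OF \<open>1 \<in> p\<close>] by auto
  then show False
    using a_subset I_notcarr by blast
qed

lemma homogeneous_elemsD: "f \<in> homogeneous_elems V \<Longrightarrow> f \<in> carrier (mpoly_ring V)"
  by (auto simp: homogeneous_elems_def graded_partD)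

lemma homogeneous_elems_mult:
  "f \<in> homogeneous_elems V \<Longrightarrow> g \<in> homogeneous_elems V \<Longrightarrow> f * g \<in> homogeneous_elems V"
  unfolding homogeneous_elems_def using graded_part_mult by blast

lemma ProjD:
  assumes "p \<in> Proj V"
  shows "primeideal p (mpoly_ring V)" and "ideal p (mpoly_ring V)" and "1 \<notin> p"
    and "\<lbrakk>f \<in> homogeneous_elems V; g \<in> homogeneous_elems V; f * g \<in> p\<rbrakk> \<Longrightarrow> f \<in> p \<or> g \<in> p"
proof -
  show p: "primeideal p (mpoly_ring V)"
    using assms by (simp add: Proj_def)
  show "ideal p (mpoly_ring V)" by (rule primeideal.axioms(1)[OF p])
  show "1 \<notin> p" by (rule one_notin_primeideal[OF p])
  show "\<lbrakk>f \<in> homogeneous_elems V; g \<in> homogeneous_elems V; f * g \<in> p\<rbrakk> \<Longrightarrow> f \<in> p \<or> g \<in> p"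
    using primeideal.I_prime[OF p, of f g] homogeneous_elemsD[of f V] homogeneous_elemsD[of g V] by simp
qed

section \<open>The Zariski topology and its closed sets\<close>

lemma openin_zariski_basic:
  "f \<in> homogeneous_elems V \<Longrightarrow> openin (zariski V) {p \<in> Proj V. f \<notin> p}"
  unfolding zariski_def by (rule topology_generated_by_Basis) blast

lemma topspace_zariski: "topspace (zariski V) = (Proj V :: ('v, 'a::field) mpol set set)"
proof -
  have "(1 :: ('v, 'a) mpol) \<in> homogeneous_elems V"
    unfolding homogeneous_elems_def using graded_part_1 by blast
  then have "p \<in> (\<Union>f\<in>homogeneous_elems V. {p \<in> Proj V. f \<notin> p})" if "p \<in> Proj V"
    for p :: "('v, 'a) mpol set"
    using that ProjD(3)[OF that] by blast
  then show ?thesis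
    unfolding zariski_def topology_generated_by_topspace by auto
qed

text \<open>\<open>topology_generated_by\<close> treats its argument as a subbasis. The
  non-vanishing loci are even a basis, because those of \<open>f\<close> and \<open>g\<close> meet
  in that of \<open>f * g\<close>: by primality for one inclusion, by absorption for the
  other.\<close>

lemma openin_zariskiE:
  fixes U :: "('v, 'a::field) mpol set set"
  assumes "openin (zariski V) U" and "p \<in> U"
  obtains f where "f \<in> homogeneous_elems V" "f \<notin> p" "{p \<in> Proj V. f \<notin> p} \<subseteq> U"
proof -
  have "\<exists>f\<in>homogeneous_elems V. f \<notin> p \<and> {p \<in> Proj V. f \<notin> p} \<subseteq> U"
    if "generate_topology_on ((\<lambda>f. {p \<in> Proj V. f \<notin> p}) ` homogeneous_elems V) U" "p \<in> U"
    using that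
  proof (induction U)
    case Empty
    then show ?case by simp
  next
    case (Int A B)
    then obtain f g where f: "f \<in> homogeneous_elems V" "f \<notin> p" "{p \<in> Proj V. f \<notin> p} \<subseteq> A"
      and g: "g \<in> homogeneous_elems V" "g \<notin> p" "{p \<in> Proj V. g \<notin> p} \<subseteq> B"
      by blast
    have "openin (zariski V) A"
      using Int.hyps(1) by (simp add: zariski_def openin_topology_generated_by_iff)
    then have p: "p \<in> Proj V"
      using openin_subset Int.prems by (fastforce simp: topspace_zariski)
    have "f * g \<notin> p"
      using ProjD(4)[OF p f(1) g(1)] f(2) g(2) by blast
    moreover have "f * g \<in> p'" if p': "p' \<in> Proj V" "f \<in> p' \<or> g \<in> p'" for p'
      using p'(2)
    proof
      assume "f \<in> p'"
      from ideal_mpoly_ringD(6)[OF ProjD(2)[OF p'(1)] this homogeneous_elemsD[OF g(1)]]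
      show ?thesis by (simp only: mult.commute)
    next
      assume "g \<in> p'"
      from ideal_mpoly_ringD(6)[OF ProjD(2)[OF p'(1)] this homogeneous_elemsD[OF f(1)]]
      show ?thesis .
    qed
    then have "{p \<in> Proj V. f * g \<notin> p} \<subseteq> A \<inter> B"
      using f(3) g(3) by blast
    ultimately show ?case
      using homogeneous_elems_mult[OF f(1) g(1)] by blast
  next
    case (UN \<U>)
    then obtain A where A: "A \<in> \<U>" "p \<in> A" by blast
    from UN.IH[OF this] show ?case
      using A(1) by blast
  next
    case (Basis A)
    then obtain f where "f \<in> homogeneous_elems V" "A = {p \<in> Proj V. f \<notin> p}" by blast
    with Basis.prems show ?case by (intro bexI[of _ f]) simp_all
  qed
  moreover have "generate_topology_on ((\<lambda>f. {p \<in> Proj V. f \<notin> p}) ` homogeneous_elems V) U"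
    using assms(1) by (simp only: zariski_def openin_topology_generated_by_iff)
  ultimately show thesis
    using assms(2) that by blast
qed

lemma topspace_subscheme_space: "topspace (subscheme_space V I) = {p \<in> Proj V. I \<subseteq> p}"
  by (auto simp: subscheme_space_def topspace_zariski)

lemma closedin_subscheme_space_zeros:
  assumes "F \<subseteq> homogeneous_elems V"
  shows "closedin (subscheme_space V I) {p \<in> Proj V. I \<subseteq> p \<and> F \<subseteq> p}"
proof -
  let ?X = "subscheme_space V I"
  have "closedin ?X {p \<in> topspace ?X. f \<in> p}" if "f \<in> F" for f
  proof -
    have "openin ?X ({p \<in> Proj V. f \<notin> p} \<inter> {p \<in> Proj V. I \<subseteq> p})"
      unfolding subscheme_space_def
      using openin_zariski_basic assms that by (intro openin_subtopology_Int) blast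
    moreover have "{p \<in> Proj V. f \<notin> p} \<inter> {p \<in> Proj V. I \<subseteq> p} = topspace ?X - {p \<in> topspace ?X. f \<in> p}"
      by (auto simp: topspace_subscheme_space)
    ultimately show ?thesis
      by (simp add: closedin_def)
  qed
  \<comment> \<open>The whole space joins the family because the intersection would be the universe
    for \<open>F = {}\<close>.\<close>
  then have "closedin ?X (\<Inter>(insert (topspace ?X) ((\<lambda>f. {p \<in> topspace ?X. f \<in> p}) ` F)))"
    by (intro closedin_Inter) auto
  moreover have "\<Inter>(insert (topspace ?X) ((\<lambda>f. {p \<in> topspace ?X. f \<in> p}) ` F)) =
      {p \<in> Proj V. I \<subseteq> p \<and> F \<subseteq> p}"
    by (auto simp: topspace_subscheme_space)
  ultimately show ?thesis by simp
qed

lemma closedin_subscheme_spaceE: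
  assumes "closedin (subscheme_space V I) Z" and "p \<in> Proj V" and "I \<subseteq> p" and "p \<notin> Z"
  obtains f where "f \<in> homogeneous_elems V" "f \<notin> p" "\<forall>p'\<in>Z. f \<in> p'"
proof -
  have Z: "Z \<subseteq> {p \<in> Proj V. I \<subseteq> p}"
    using closedin_subset[OF assms(1)] by (simp add: topspace_subscheme_space)
  have "openin (subscheme_space V I) ({p \<in> Proj V. I \<subseteq> p} - Z)"
    using assms(1) by (simp add: closedin_def topspace_subscheme_space)
  then obtain U where U: "openin (zariski V) U" "{p \<in> Proj V. I \<subseteq> p} - Z = U \<inter> {p \<in> Proj V. I \<subseteq> p}"
    unfolding subscheme_space_def openin_subtopology by blast
  have "p \<in> U" using assms(2-4) U(2) by blast
  then obtain f where "f \<in> homogeneous_elems V" "f \<notin> p" "{p \<in> Proj V. f \<notin> p} \<subseteq> U"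
    using openin_zariskiE[OF U(1)] by blast
  with Z U(2) show thesis
    by (intro that[of f]) blast+
qed

text \<open>The ideals are the vanishing ideals \<open>\<Inter>(Z i)\<close>. Irreducibility becomes
  primality for forms, and a point of \<open>Z (Suc i)\<close> outside \<open>Z i\<close> is
  separated from \<open>Z i\<close> by a form.\<close>

lemma chain_of_closed_sets:
  fixes I :: "('v, 'a::field) mpol set"
  assumes irr: "\<forall>i\<le>n. irreducible_closed (subscheme_space V I) (Z i)"
    and chain: "\<forall>i<n. Z i \<subset> Z (Suc i)"
  obtains J g d z e where "prime_chain V n J g d z e" "I \<subseteq> J n"
proof -
  let ?X = "subscheme_space V I"
  have closed: "closedin ?X (Z i)" and nonempty: "Z i \<noteq> {}" if "i \<le> n" for i
    using irr that by (auto simp: irreducible_closed_def)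
  have Z: "Z i \<subseteq> {p \<in> Proj V. I \<subseteq> p}" if "i \<le> n" for i
    using closedin_subset[OF closed[OF that]] by (simp add: topspace_subscheme_space)
  define J where "J i = \<Inter>(Z i)" for i
  have J_ideal: "ideal (J i) (mpoly_ring V)" if "i \<le> n" for i
    unfolding J_def
    using ring.i_Intersect[OF ring_mpoly_ring, of "Z i" V] Z[OF that] ProjD(2) nonempty[OF that] by blast
  have J_prime: "f \<in> J i \<or> h \<in> J i"
    if i: "i \<le> n" and f: "f \<in> homogeneous_elems V" and h: "h \<in> homogeneous_elems V" and fh: "f * h \<in> J i"
    for i f h
  proof -
    \<comment> \<open>If \<open>f * h\<close> vanishes on \<open>Z i\<close>, the zero sets of
      \<open>f\<close> and \<open>h\<close> cover it, so one of them is all of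
      \<open>Z i\<close>.\<close>
    let ?A = "\<lambda>f. Z i \<inter> {p \<in> Proj V. I \<subseteq> p \<and> {f} \<subseteq> p}"
    have "irreducible_closed ?X (Z i)" using irr i by blast
    then have irr_i: "\<forall>A B. closedin ?X A \<longrightarrow> closedin ?X B \<longrightarrow> Z i = A \<union> B \<longrightarrow> Z i = A \<or> Z i = B"
      unfolding irreducible_closed_def by (elim conjE)
    have A: "closedin ?X (?A f)" "closedin ?X (?A h)"
      using closedin_subscheme_space_zeros[of "{f}" V I] closedin_subscheme_space_zeros[of "{h}" V I] f h
      by (auto intro!: closedin_Int closed[OF i])
    have "p \<in> ?A f \<union> ?A h" if p: "p \<in> Z i" for p
    proof -
      have "p \<in> Proj V" "I \<subseteq> p" "f * h \<in> p"
        using Z[OF i] p fh by (auto simp: J_def)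
      then show ?thesis
        using p ProjD(4)[OF _ f h, of p] by blast
    qed
    then have "Z i = ?A f \<union> ?A h" by blast
    from irr_i[rule_format, OF A this] have "Z i = ?A f \<or> Z i = ?A h" .
    then show ?thesis by (auto simp: J_def)
  qed
  have "\<exists>f t. f \<in> graded_part V t \<and> f \<in> J i \<and> f \<notin> J (Suc i)" if i: "i < n" for i
  proof -
    obtain p where p: "p \<in> Z (Suc i)" "p \<notin> Z i"
      using chain i by blast
    then have "p \<in> Proj V" "I \<subseteq> p"
      using Z[of "Suc i"] i by auto
    then obtain f where "f \<in> homogeneous_elems V" "f \<notin> p" "\<forall>p'\<in>Z i. f \<in> p'"
      using closedin_subscheme_spaceE[OF closed[OF less_imp_le[OF i]] _ _ p(2)] by blast
    with p(1) show ?thesis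
      unfolding J_def homogeneous_elems_def by blast
  qed
  then obtain g d where g: "\<And>i. i < n \<Longrightarrow> g i \<in> graded_part V (d i) \<and> g i \<in> J i \<and> g i \<notin> J (Suc i)"
    by metis
  obtain p where p: "p \<in> Z 0" using nonempty[of 0] by blast
  then have "p \<in> Proj V" using Z[of 0] by auto
  \<comment> \<open>A point of the smallest set does not contain the irrelevant ideal, so it misses
    some form of positive degree, which is then outside \<open>J 0\<close>.\<close>
  then have "\<not> (\<Union>t\<in>{0<..}. graded_part V t) \<subseteq> p"
    using genideal_mpoly_ring_le[of p V] by (auto simp: Proj_def irrelevant_ideal_def primeideal_def)
  then obtain z e where z: "e > 0" "z \<in> graded_part V e" "z \<notin> p" by blast
  have "prime_chain V n J g d z e"
  proof (rule prime_chain.intro)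
    show "J (Suc i) \<subseteq> J i" if "i < n" for i
      using chain that unfolding J_def by blast
    show "z \<notin> J 0" using z(3) p by (auto simp: J_def)
    show "f \<in> J i \<or> h \<in> J i"
      if "i \<le> n" "f \<in> homogeneous_elems V" "h \<in> homogeneous_elems V" "f * h \<in> J i" for i f h
      using that by (rule J_prime)
    show "g i \<in> J i" "g i \<notin> J (Suc i)" "g i \<in> graded_part V (d i)" if "i < n" for i
      using g[OF that] by simp_all
  qed (rule J_ideal z(1) z(2), assumption?)+
  moreover have "I \<subseteq> J n"
    using Z[OF order_refl] by (auto simp: J_def)
  ultimately show thesis by (rule that)
qed

section \<open>Coordinate subspaces and their homogeneous primes\<close>

definition coordinate_ideal :: "'v set \<Rightarrow> 'v set \<Rightarrow> ('v, 'a::field) mpol set" where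
  "coordinate_ideal V W =
    {f \<in> carrier (mpoly_ring V). \<forall>m\<in>Poly_Mapping.keys f. \<not> Poly_Mapping.keys m \<subseteq> W}"

definition restrict_vars :: "'v set \<Rightarrow> ('v, 'a::field) mpol \<Rightarrow> ('v, 'a) mpol" where
  "restrict_vars W = linear_extension (\<lambda>m. if Poly_Mapping.keys m \<subseteq> W then monomial m else 0)"

lemma lookup_restrict_vars:
  "Poly_Mapping.lookup (restrict_vars W f) m =
    (if Poly_Mapping.keys m \<subseteq> W then Poly_Mapping.lookup f m else 0)"
proof -
  have "Poly_Mapping.lookup (restrict_vars W f) m =
      (\<Sum>m'\<in>Poly_Mapping.keys f. Poly_Mapping.lookup f m' *
        (if Poly_Mapping.keys m' \<subseteq> W then Poly_Mapping.lookup (monomial m') m else 0))"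
    unfolding restrict_vars_def linear_extension_def lookup_sum lookup_single_zero_mult
    by (intro sum.cong) auto
  also have "\<dots> = (\<Sum>m'\<in>Poly_Mapping.keys f. if m' = m then
      (if Poly_Mapping.keys m \<subseteq> W then Poly_Mapping.lookup f m else 0) else 0)"
    by (intro sum.cong) (auto simp: lookup_single)
  also have "\<dots> = (if Poly_Mapping.keys m \<subseteq> W then Poly_Mapping.lookup f m else 0)"
    by (auto simp: sum.delta in_keys_iff)
  finally show ?thesis .
qed

lemma restrict_vars_mult: "restrict_vars W (f * g) = restrict_vars W f * restrict_vars W g"
  unfolding restrict_vars_def
proof (rule linear_extension_mult)
  fix a b :: "'a \<Rightarrow>\<^sub>0 nat"
  show "(if Poly_Mapping.keys (a + b) \<subseteq> W then monomial (a + b) else 0) =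
      (if Poly_Mapping.keys a \<subseteq> W then monomial a else 0) *
      (if Poly_Mapping.keys b \<subseteq> W then monomial b else 0 :: ('a, 'b) mpol)"
    unfolding keys_add_nat monomial_add by simp
qed

lemma coordinate_ideal_iff:
  "f \<in> coordinate_ideal V W \<longleftrightarrow> f \<in> carrier (mpoly_ring V) \<and> restrict_vars W f = 0"
proof -
  have "restrict_vars W f = 0 \<longleftrightarrow> (\<forall>m. Poly_Mapping.lookup (restrict_vars W f) m = 0)"
    using poly_mapping_eqI[of "restrict_vars W f" 0] by auto
  also have "\<dots> \<longleftrightarrow> (\<forall>m\<in>Poly_Mapping.keys f. \<not> Poly_Mapping.keys m \<subseteq> W)"
    unfolding lookup_restrict_vars in_keys_iff Ball_def by meson
  finally show ?thesis
    unfolding coordinate_ideal_def by blast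
qed

lemma restrict_vars_add: "restrict_vars W (f + g) = restrict_vars W f + restrict_vars W g"
  and restrict_vars_0 [simp]: "restrict_vars W 0 = 0"
  by (simp_all add: restrict_vars_def linear_extension_add)

text \<open>This is the kernel of the endomorphism that sets the variables outside \<open>W\<close>
  to 0, with values in a domain. The linear order on the variables makes the polynomial type a
  domain; for \<open>idx\<close> it is the lexicographic one.\<close>

lemma primeideal_coordinate_ideal:
  fixes V :: "'v::linorder set"
  shows "primeideal (coordinate_ideal V W :: ('v, 'a::field) mpol set) (mpoly_ring V)"
proof (rule primeidealI)
  show "ideal (coordinate_ideal V W :: ('v, 'a) mpol set) (mpoly_ring V)"
    by (rule ideal_mpoly_ringI)
      (auto simp: coordinate_ideal_iff restrict_vars_add restrict_vars_mult)
  show "cring (mpoly_ring V :: ('v, 'a) mpol ring)" by (rule cring_mpoly_ring)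
  have "(1 :: ('v, 'a) mpol) \<notin> coordinate_ideal V W"
    by (simp add: coordinate_ideal_def)
  then show "carrier (mpoly_ring V) \<noteq> (coordinate_ideal V W :: ('v, 'a) mpol set)"
    using mpoly_ring_closed(2) by metis
  show "f \<in> coordinate_ideal V W \<or> g \<in> coordinate_ideal V W"
    if "f \<in> carrier (mpoly_ring V)" "g \<in> carrier (mpoly_ring V)"
      "f \<otimes>\<^bsub>mpoly_ring V\<^esub> g \<in> coordinate_ideal V W"
    for f g :: "('v, 'a) mpol"
    using that by (simp add: coordinate_ideal_iff restrict_vars_mult)
qed

lemma Var_in_coordinate_ideal_iff:
  "v \<in> V \<Longrightarrow> (Var v :: ('v, 'a::field) mpol) \<in> coordinate_ideal V W \<longleftrightarrow> v \<notin> W"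
proof -
  assume "v \<in> V"
  then have "(Var v :: ('v, 'a) mpol) \<in> carrier (mpoly_ring V)"
    by (rule Var_in_carrier)
  moreover have "Poly_Mapping.keys (Var v :: ('v, 'a) mpol) = {Poly_Mapping.single v 1}"
    by (simp add: Var_def)
  ultimately show ?thesis
    by (simp add: coordinate_ideal_def)
qed

lemma Var_in_graded_part: "v \<in> V \<Longrightarrow> Var v \<in> graded_part V 1"
  unfolding Var_def using single_in_graded_part[of "Poly_Mapping.single v 1" V 1] by simp

lemma Var_homogeneous: "v \<in> V \<Longrightarrow> Var v \<in> homogeneous_elems V"
  unfolding homogeneous_elems_def by (rule UN_I[OF UNIV_I]) (rule Var_in_graded_part)

text \<open>The coordinate ideal is generated by the variables outside \<open>W\<close>, since every
  monomial occurring in it has such a factor. Containment in \<open>p\<close> is thus a condition on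
  variables, which exhibits the subspace as a closed set.\<close>

lemma coordinate_ideal_subset_iff:
  fixes p :: "('v, 'a::field) mpol set"
  assumes p: "ideal p (mpoly_ring V)"
  shows "coordinate_ideal V W \<subseteq> p \<longleftrightarrow> Var ` (V - W) \<subseteq> p"
proof
  assume *: "coordinate_ideal V W \<subseteq> p"
  show "Var ` (V - W) \<subseteq> p"
  proof (rule image_subsetI)
    fix v assume "v \<in> V - W"
    then have "(Var v :: ('v, 'a) mpol) \<in> coordinate_ideal V W"
      by (simp add: Var_in_coordinate_ideal_iff)
    with * show "Var v \<in> p" by (rule subsetD)
  qed
next
  assume Var: "Var ` (V - W) \<subseteq> p"
  show "coordinate_ideal V W \<subseteq> p"
  proof
    fix f :: "('v, 'a) mpol" assume f: "f \<in> coordinate_ideal V W"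
    have "Poly_Mapping.single m (Poly_Mapping.lookup f m) \<in> p" if m: "m \<in> Poly_Mapping.keys f" for m
    proof -
      have mV: "Poly_Mapping.keys m \<subseteq> V" "\<not> Poly_Mapping.keys m \<subseteq> W"
        using f m by (auto simp: coordinate_ideal_def in_carrier_mpoly_ring)
      then obtain v where v: "v \<in> Poly_Mapping.keys m" "v \<notin> W" by blast
      obtain m' where m': "m = Poly_Mapping.single v 1 + m'"
        using poly_mapping_split_single[OF v(1)] .
      have "Poly_Mapping.single m' (Poly_Mapping.lookup f m) * Var v \<in> p"
        using v mV Var by (intro ideal_mpoly_ringD(6)[OF p] single_in_carrier) (auto simp: m' keys_add_nat)
      then show ?thesis
        by (simp add: Var_def mult_single m' add.commute)
    qed
    then have "(\<Sum>m\<in>Poly_Mapping.keys f. Poly_Mapping.single m (Poly_Mapping.lookup f m)) \<in> p"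
      by (rule ideal_sum[OF p])
    then show "f \<in> p"
      by (simp only: poly_mapping_eq_sum_single[symmetric])
  qed
qed

text \<open>Homogeneity holds because the generators are variables; a variable from the nonempty
  \<open>W\<close> shows that the irrelevant ideal is not contained.\<close>

lemma coordinate_ideal_in_Proj:
  fixes V :: "'v::linorder set"
  assumes "W \<subseteq> V" and "W \<noteq> {}"
  shows "(coordinate_ideal V W :: ('v, 'a::field) mpol set) \<in> Proj V"
proof -
  let ?P = "coordinate_ideal V W :: ('v, 'a) mpol set"
  have prime: "primeideal ?P (mpoly_ring V)" by (rule primeideal_coordinate_ideal)
  then have P: "ideal ?P (mpoly_ring V)" by (rule primeideal.axioms)
  let ?H = "?P \<inter> homogeneous_elems V"
  have H: "?H \<subseteq> carrier (mpoly_ring V)"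
    using homogeneous_elemsD by blast
  have "Var ` (V - W) \<subseteq> ?H"
  proof
    fix f :: "('v, 'a) mpol" assume "f \<in> Var ` (V - W)"
    then obtain v where v: "v \<in> V" "v \<notin> W" "f = Var v" by blast
    then show "f \<in> ?H"
      using Var_homogeneous[OF v(1)] Var_in_coordinate_ideal_iff[OF v(1), of W] by simp
  qed
  also have "\<dots> \<subseteq> Idl\<^bsub>mpoly_ring V\<^esub> ?H"
    by (rule genideal_mpoly_ring(2)[OF H])
  finally have "?P \<subseteq> Idl\<^bsub>mpoly_ring V\<^esub> ?H"
    unfolding coordinate_ideal_subset_iff[OF genideal_mpoly_ring(1)[OF H]] .
  moreover have "Idl\<^bsub>mpoly_ring V\<^esub> ?H \<subseteq> ?P"
    using genideal_mpoly_ring_le[OF P, of ?H] by blast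
  ultimately have "homogeneous_ideal V ?P"
    unfolding homogeneous_ideal_def using P by blast
  moreover have "\<not> irrelevant_ideal V \<subseteq> ?P"
  proof
    assume "irrelevant_ideal V \<subseteq> ?P"
    moreover obtain v where v: "v \<in> W" using assms(2) by blast
    moreover have "(\<Union>t\<in>{0<..}. graded_part V t) \<subseteq> (irrelevant_ideal V :: ('v, 'a) mpol set)"
      unfolding irrelevant_ideal_def
      by (rule genideal_mpoly_ring(2)) (use graded_partD(1) in blast)
    moreover have "Var v \<in> (\<Union>t\<in>{0<..}. graded_part V t :: ('v, 'a) mpol set)"
      using v assms(1) by (intro UN_I[of 1] Var_in_graded_part) auto
    ultimately have "(Var v :: ('v, 'a) mpol) \<in> ?P" by (meson subsetD)
    moreover have "v \<in> V" using v assms(1) by (rule subsetD[rotated])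
    ultimately show False
      using v by (simp add: Var_in_coordinate_ideal_iff)
  qed
  ultimately show ?thesis
    using prime by (simp add: Proj_def)
qed

text \<open>\<open>P\<close> is a generic point: a form in \<open>P\<close> lies in every
  \<open>p\<close> containing \<open>P\<close>, so a closed set through \<open>P\<close> contains
  the whole set. In a cover by two closed sets, the one through \<open>P\<close> is
  everything.\<close>

lemma irreducible_closed_zeros:
  assumes "P \<in> Proj V" and "I \<subseteq> P"
    and "closedin (subscheme_space V I) {p \<in> Proj V. P \<subseteq> p}"
  shows "irreducible_closed (subscheme_space V I) {p \<in> Proj V. P \<subseteq> p}"
  unfolding irreducible_closed_def
proof (intro conjI allI impI)
  have P: "P \<in> {p \<in> Proj V. P \<subseteq> p}" using assms(1) by simp
  then show "{p \<in> Proj V. P \<subseteq> p} \<noteq> {}" by (metis empty_iff)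
  fix A B
  assume A: "closedin (subscheme_space V I) A" and B: "closedin (subscheme_space V I) B"
    and AB: "{p \<in> Proj V. P \<subseteq> p} = A \<union> B"
  have "{p \<in> Proj V. P \<subseteq> p} \<subseteq> C" if C: "closedin (subscheme_space V I) C" "P \<in> C" for C
  proof (rule subsetI, rule ccontr)
    fix p assume p: "p \<in> {p \<in> Proj V. P \<subseteq> p}" "p \<notin> C"
    then have "p \<in> Proj V" "P \<subseteq> p" by simp_all
    moreover from this have "I \<subseteq> p" by (intro order_trans[OF assms(2)])
    ultimately obtain f where "f \<notin> p" "\<forall>p'\<in>C. f \<in> p'"
      using closedin_subscheme_spaceE[OF C(1) _ _ p(2)] by metis
    with C(2) \<open>P \<subseteq> p\<close> show False by (meson subsetD)
  qed
  note sub = this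
  from P have "P \<in> A \<or> P \<in> B" unfolding AB by simp
  then show "{p \<in> Proj V. P \<subseteq> p} = A \<or> {p \<in> Proj V. P \<subseteq> p} = B"
    using sub[OF A] sub[OF B] unfolding AB by (metis Un_upper1 Un_upper2 subset_antisym)
qed (rule assms(3))

section \<open>Coordinate subspaces inside the subscheme\<close>

context jordan_component
begin

text \<open>For blocks with \<open>a \<le> j\<close>, the \<open>x(a,b,1)\<close> are the only
  variables that are not nilpotent modulo \<open>q\<close>, so every other variable vanishes at all
  points of the subscheme.\<close>

definition base_vars :: "(nat \<times> nat) set \<Rightarrow> idx set" where
  "base_vars B = (\<lambda>(a, b). (a, b, 1)) ` B"

lemma base_vars_good: "B \<subseteq> blocks \<Longrightarrow> base_vars B \<subseteq> good"
  using r_j_pos by (auto simp: base_vars_def blocks_def good_def)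

lemma base_vars_subset: "B \<subseteq> blocks \<Longrightarrow> base_vars B \<subseteq> V"
  using base_vars_good good_subset by (rule order_trans)

lemma base_vars_empty_iff: "base_vars B = {} \<longleftrightarrow> B = {}"
  by (simp add: base_vars_def)

text \<open>A monomial in the variables of \<open>base_vars B\<close> has weight 0 and is the only
  monomial of \<open>f\<close> in its class. Its coefficient is therefore a class coefficient below
  \<open>r j\<close>, which vanishes on the kernel.\<close>

lemma q_subset_coordinate_ideal:
  assumes "B \<subseteq> blocks"
  shows "q \<subseteq> coordinate_ideal V (base_vars B)"
proof
  fix f assume "f \<in> q"
  then have f: "f \<in> kernel" by (simp add: q_eq_kernel)
  then have carrier: "f \<in> carrier R" by (simp add: kernel_def)
  have "\<not> Poly_Mapping.keys m \<subseteq> base_vars B" if m: "m \<in> Poly_Mapping.keys f" for m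
  proof
    assume mB: "Poly_Mapping.keys m \<subseteq> base_vars B"
    have "weight v = 0" if "v \<in> base_vars B" for v
      using that assms by (auto simp: base_vars_def blocks_def weight_def)
    then have "weight v = 0" if "v \<in> Poly_Mapping.keys m" for v
      using subsetD[OF mB that] by blast
    then have m_weight: "snd (mon_class m) = 0"
      by (simp add: snd_mon_class)
    have unique: "m' = base_monomial (fst (mon_class m))"
      if m': "m' \<in> Poly_Mapping.keys f" "mon_class m' = mon_class m" for m'
    proof -
      have "Poly_Mapping.keys m' \<subseteq> good"
      proof
        fix v assume v: "v \<in> Poly_Mapping.keys m'"
        then have "v \<in> V" using carrier m'(1) by (auto simp: in_carrier_mpoly_ring)
        moreover have "weight v < r j"
          using weight_le_mon_class[OF v] m'(2) m_weight r_j_pos by simp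
        ultimately show "v \<in> good" using weight_not_good by fastforce
      qed
      then show ?thesis
        using base_monomial_mon_class[of m'] m'(2) m_weight by simp
    qed
    have "m' = m" if "m' \<in> Poly_Mapping.keys f" "mon_class m' = mon_class m" for m'
      using unique[OF that] unique[OF m refl] by simp
    with m have "{m' \<in> Poly_Mapping.keys f. mon_class m' = mon_class m} = {m}"
      by blast
    then have "class_coeff f (mon_class m) = Poly_Mapping.lookup f m"
      by (simp add: class_coeff_eq)
    moreover have "class_coeff f (mon_class m) = 0"
      using kernelD[OF f] m_weight r_j_pos by simp
    ultimately show False using m by (simp add: in_keys_iff)
  qed
  with carrier show "f \<in> coordinate_ideal V (base_vars B)"
    by (simp add: coordinate_ideal_def)
qed

lemma irreducible_closed_coordinate_ideal:
  assumes "B \<subseteq> blocks" and "B \<noteq> {}"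
  shows "irreducible_closed (subscheme_space V q) {p \<in> Proj V. coordinate_ideal V (base_vars B) \<subseteq> p}"
proof (rule irreducible_closed_zeros)
  let ?P = "coordinate_ideal V (base_vars B)"
  show "?P \<in> Proj V"
    using assms by (intro coordinate_ideal_in_Proj base_vars_subset) (simp_all add: base_vars_empty_iff)
  show qP: "q \<subseteq> ?P" by (rule q_subset_coordinate_ideal[OF assms(1)])
  \<comment> \<open>Inside the subscheme the subspace is cut out by the variables that vanish on it,
    hence closed.\<close>
  have "?P \<subseteq> p \<longleftrightarrow> q \<subseteq> p \<and> Var ` (V - base_vars B) \<subseteq> p" if "p \<in> Proj V" for p
    using coordinate_ideal_subset_iff[OF ProjD(2)[OF that], of "base_vars B"] order_trans[OF qP, of p] by metis
  then have "{p \<in> Proj V. ?P \<subseteq> p} = {p \<in> Proj V. q \<subseteq> p \<and> Var ` (V - base_vars B) \<subseteq> p}"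
    by (intro Collect_cong conj_cong refl)
  moreover have "closedin (subscheme_space V q) {p \<in> Proj V. q \<subseteq> p \<and> Var ` (V - base_vars B) \<subseteq> p}"
    by (intro closedin_subscheme_space_zeros image_subsetI Var_homogeneous) simp
  ultimately show "closedin (subscheme_space V q) {p \<in> Proj V. ?P \<subseteq> p}" by simp
qed

lemma coordinate_chain:
  "\<exists>Z. (\<forall>i\<le>K - 1. irreducible_closed (subscheme_space V q) (Z i)) \<and> (\<forall>i<K - 1. Z i \<subset> Z (Suc i))"
proof -
  obtain bs where bs: "set bs = blocks" "distinct bs"
    using finite_distinct_list[OF finite_blocks] by blast
  then have len: "length bs = K"
    using distinct_card[of bs] by (simp add: card_blocks)
  \<comment> \<open>\<open>Suc i\<close> blocks at stage \<open>i\<close>: the sets are nonempty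
    from \<open>i = 0\<close> on, and all \<open>K\<close> blocks are used at
    \<open>i = K - 1\<close>.\<close>
  define B where "B i = set (take (Suc i) bs)" for i
  define P where "P i = (coordinate_ideal V (base_vars (B i)) :: (idx, 'a) mpol set)" for i
  define Z where "Z i = {p \<in> Proj V. P i \<subseteq> p}" for i
  have B: "B i \<subseteq> blocks" "B i \<noteq> {}" for i
    using set_take_subset[of "Suc i" bs] bs(1) len K_pos by (auto simp: B_def)
  have "Z i \<subset> Z (Suc i)" if "i < K - 1" for i
  proof -
    have "Suc i < length bs" using that len by simp
    then have B_Suc: "B (Suc i) = insert (bs ! Suc i) (B i)"
      by (simp add: B_def take_Suc_conv_app_nth insert_commute)
    have "bs ! Suc i \<notin> B i"
      using bs(2) \<open>Suc i < length bs\<close> by (auto simp: B_def in_set_conv_nth nth_eq_iff_index_eq)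
    obtain a b where ab: "bs ! Suc i = (a, b)" by (cases "bs ! Suc i")
    let ?v = "(a, b, 1)"
    have v: "?v \<in> base_vars (B (Suc i))" "?v \<notin> base_vars (B i)"
      using ab B_Suc \<open>bs ! Suc i \<notin> B i\<close> by (auto simp: base_vars_def)
    then have "?v \<in> V" using base_vars_subset[OF B(1)] by (meson subsetD)
    then have "Var ?v \<in> P i" "Var ?v \<notin> P (Suc i)"
      using v by (simp_all add: P_def Var_in_coordinate_ideal_iff)
    moreover have "P (Suc i) \<subseteq> P i"
      using B_Suc by (auto simp: P_def coordinate_ideal_def base_vars_def)
    moreover have "P (Suc i) \<in> Proj V"
      unfolding P_def using B by (intro coordinate_ideal_in_Proj base_vars_subset) (simp_all add: base_vars_empty_iff)
    ultimately have "P (Suc i) \<in> Z (Suc i)" "P (Suc i) \<notin> Z i" "Z i \<subseteq> Z (Suc i)"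
      unfolding Z_def by auto
    then show ?thesis by (metis psubsetI)
  qed
  moreover have "irreducible_closed (subscheme_space V q) (Z i)" for i
    unfolding Z_def P_def by (rule irreducible_closed_coordinate_ideal[OF B])
  ultimately show ?thesis by blast
qed

lemma subscheme_dim_q: "subscheme_dim V q = ereal (real K - 1)"
proof -
  have K: "ereal (real K - 1) = ereal (real (K - 1))"
    using K_pos by (simp add: of_nat_diff)
  show ?thesis
    unfolding subscheme_dim_def top_dim_def K
  proof (rule antisym)
    show "(SUP n\<in>{n. \<exists>Z. (\<forall>i\<le>n. irreducible_closed (subscheme_space V q) (Z i)) \<and>
        (\<forall>i<n. Z i \<subset> Z (Suc i))}. ereal (real n)) \<le> ereal (real (K - 1))"
    proof (rule SUP_least)
      fix n assume "n \<in> {n. \<exists>Z. (\<forall>i\<le>n. irreducible_closed (subscheme_space V q) (Z i)) \<and>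
        (\<forall>i<n. Z i \<subset> Z (Suc i))}"
      then obtain Z where Z: "\<forall>i\<le>n. irreducible_closed (subscheme_space V q) (Z i)"
          "\<forall>i<n. Z i \<subset> Z (Suc i)"
        by blast
      obtain J g d z e where "prime_chain V n J g d z e" "q \<subseteq> J n"
        using chain_of_closed_sets[OF Z] .
      then have "n < K" by (rule prime_chain_length)
      then have "n \<le> K - 1" by linarith
      then show "ereal (real n) \<le> ereal (real (K - 1))"
        by (simp only: ereal_less_eq of_nat_le_iff)
    qed
    show "ereal (real (K - 1)) \<le> (SUP n\<in>{n. \<exists>Z. (\<forall>i\<le>n. irreducible_closed (subscheme_space V q) (Z i)) \<and>
        (\<forall>i<n. Z i \<subset> Z (Suc i))}. ereal (real n))"
      by (rule SUP_upper) (use coordinate_chain in simp)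
  qed
qed

end

theorem proposition3p15:
  fixes lam :: "'a::field" and l j :: nat and k r :: "nat \<Rightarrow> nat"
  assumes "l \<ge> 1"
    and "\<forall>i\<in>{1..l}. k i > 0"
    and "\<forall>i\<in>{1..l}. r i > 0"
    and "strict_antimono_on {1..l} r"
    and "j \<in> {1..l}"
  shows "has_hilbert_poly (Lam l k r) (q_ideal lam l k r j)
           (smult (of_nat (r j)) (binom_poly ((\<Sum>i=1..j. k i) - 1)))
      \<and> subscheme_dim (Lam l k r) (q_ideal lam l k r j) = ereal (real (\<Sum>i=1..j. k i) - 1)
      \<and> subscheme_degree (Lam l k r) (q_ideal lam l k r j) = of_nat (r j)"
proof -
  interpret jordan_component lam l k r j
    using assms by unfold_locales auto
  show ?thesis
    using has_hilbert_poly_q subscheme_dim_q subscheme_degree_q by blast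
qed

end
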